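(* Let $D=(V,A)$ be a skeletal directed acyclic graph. For any $\mho,\Omega\subseteq V$ and any acyclic reorientation $E$ of $D$, the following statements are equivalent: (i) $E$ is minimal (resp. maximal) in its $\equiv_{(\mho,\Omega)}$-congruence class; (ii) $\nabla_{u,v}^E\subseteq\mho$ and $\Delta_{u,v}^E\subseteq\Omega$ for any arc $(u,v)$ of $D$ reversed (resp. unreversed) in the transitive reduction of $E$, i.e. such that $(v,u)$ (resp. $(u,v)$) is an arc of the transitive reduction of $E$; (iii) $\nabla_{u,v}^E\subseteq\mho$ and $\Delta_{u,v}^E\subseteq\Omega$ for any arc $(u,v)$ of $D$ reversed (resp. unreversed) in $E$.
   Context: All directed graphs are finite and simple. A reorientation of a directed acyclic graph $D=(V,A)$ is a directed graph with the same underlying undirected graph, encoded by the set of arcs of $D$ that it reverses. $\mathcal{AR}_D$ is the poset of acyclic reorientations of $D$ ordered by inclusion of sets of reversed arcs. The transitive reduction of a directed acyclic graph is obtained by deleting all arcs whose endpoints are connected by a directed path of length at least $2$. A directed graph is a forest if its underlying undirected graph has no cycle. $D$ is vertebrate if the transitive reduction of every induced subgraph of $D$ is a forest; filled if for any directed path $\pi$ in $D$ whose endpoints are joined by an arc of $D$, all arcs joining any two vertices of $\pi$ belong to $D$; skeletal if vertebrate and filled. When $D$ is skeletal, $\mathcal{AR}_D$ is a lattice. A congruence of a lattice is an equivalence relation compatible with meets and joins. It contracts a join irreducible $J$ (covering a unique element $J_\star$) if $J_\star\equiv J$. The transitive support of an arc $(u,v)$ of $D$ is the set of vertices appearing along directed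 paths in $D$ from $u$ to $v$. A rope of $D$ is a quadruple $(u,v,\nabla,\Delta)$ where $(u,v)\in A$ and $\nabla\sqcup\Delta$ is a partition of the transitive support of $(u,v)$ minus $\{u,v\}$. For a rope $\rho=(u,v,\nabla,\Delta)$, let $I_\vee(\rho)$ be the acyclic reorientation of $D$ where an arc $(w,w')$ of $D$ is reversed if and only if $w\in\Delta\cup\{u\}$ and $w'\in\nabla\cup\{v\}$; $\rho\mapsto I_\vee(\rho)$ is a bijection from the ropes of $D$ to the join irreducibles of $\mathcal{AR}_D$. For $\mho,\Omega\subseteq V$, the coherent congruence $\equiv_{(\mho,\Omega)}$ is the unique congruence of $\mathcal{AR}_D$ whose uncontracted join irreducibles are exactly the $I_\vee(\rho)$ for the ropes $\rho=(u,v,\nabla,\Delta)$ of $D$ with $\nabla\subseteq\mho$ and $\Delta\subseteq\Omega$. For an acyclic reorientation $E$ of $D$ and an arc $(u,v)$ of $D$, $\nabla_{u,v}^E=\{w\in V : (u,w)\in D\setminus E,\ (w,v)\in D\cap E\}$ and $\Delta_{u,v}^E=\{w\in V : (u,w)\in D\cap E,\ (w,v)\in D\setminus E\}$ (membership refers to arcs). *)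

theory Defs
  imports "HOL-Algebra.Lattice"
begin

text \<open>
  A finite simple directed acyclic graph is given by its vertex set \<open>V\<close> and its arc relation \<open>A\<close>.
  Acyclicity excludes loops and pairs of opposite arcs.
\<close>

definition dag :: "'a set \<Rightarrow> ('a \<times> 'a) set \<Rightarrow> bool" where
  "dag V A \<longleftrightarrow> finite V \<and> A \<subseteq> V \<times> V \<and> acyclic A"

definition dipath :: "('a \<times> 'a) set \<Rightarrow> 'a list \<Rightarrow> bool" where
  "dipath A p \<longleftrightarrow> p \<noteq> [] \<and> distinct p \<and> successively (\<lambda>x y. (x, y) \<in> A) p"

text \<open>A path of length at least \<open>2\<close> has at least \<open>3\<close> vertices.\<close>

definition transitive_reduction :: "('a \<times> 'a) set \<Rightarrow> ('a \<times> 'a) set" where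
  "transitive_reduction A =
     {(u, v) \<in> A. \<not> (\<exists>p. dipath A p \<and> hd p = u \<and> last p = v \<and> length p \<ge> 3)}"

text \<open>No cycle in the underlying undirected graph.\<close>

definition forest :: "('a \<times> 'a) set \<Rightarrow> bool" where
  "forest A \<longleftrightarrow>
     \<not> (\<exists>c. length c \<ge> 3 \<and> dipath (A \<union> A\<inverse>) c \<and> (last c, hd c) \<in> A \<union> A\<inverse>)"

definition vertebrate :: "'a set \<Rightarrow> ('a \<times> 'a) set \<Rightarrow> bool" where
  "vertebrate V A \<longleftrightarrow> (\<forall>U \<subseteq> V. forest (transitive_reduction (Restr A U)))"

text \<open>
  For acyclic \<open>A\<close>, an arc joining two vertices of a directed path can only
  point in the direction of the path.
\<close>

definition filled :: "('a \<times> 'a) set \<Rightarrow> bool" where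
  "filled A \<longleftrightarrow>
     (\<forall>p. dipath A p \<and> (hd p, last p) \<in> A \<longrightarrow>
        (\<forall>i j. i < j \<and> j < length p \<longrightarrow> (p ! i, p ! j) \<in> A))"

definition skeletal :: "'a set \<Rightarrow> ('a \<times> 'a) set \<Rightarrow> bool" where
  "skeletal V A \<longleftrightarrow> vertebrate V A \<and> filled A"

text \<open>
  A reorientation is represented by the set \<open>R\<close> of arcs of \<open>A\<close> that it reverses;
  \<open>reorient A R\<close> is its arc relation.
\<close>

definition reorient :: "('a \<times> 'a) set \<Rightarrow> ('a \<times> 'a) set \<Rightarrow> ('a \<times> 'a) set" where
  "reorient A R = (A - R) \<union> R\<inverse>"

definition acyclic_reorientations :: "('a \<times> 'a) set \<Rightarrow> ('a \<times> 'a) set set" where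
  "acyclic_reorientations A = {R. R \<subseteq> A \<and> acyclic (reorient A R)}"

definition AR :: "('a \<times> 'a) set \<Rightarrow> ('a \<times> 'a) set gorder" where
  "AR A = \<lparr>carrier = acyclic_reorientations A, eq = (=), le = (\<subseteq>)\<rparr>"

definition lattice_congruence :: "('b, 'c) gorder_scheme \<Rightarrow> ('b \<times> 'b) set \<Rightarrow> bool" where
  "lattice_congruence L \<theta> \<longleftrightarrow>
     equiv (carrier L) \<theta> \<and>
     (\<forall>x x' y y'. (x, x') \<in> \<theta> \<and> (y, y') \<in> \<theta> \<longrightarrow>
        (x \<sqinter>\<^bsub>L\<^esub> y, x' \<sqinter>\<^bsub>L\<^esub> y') \<in> \<theta> \<and> (x \<squnion>\<^bsub>L\<^esub> y, x' \<squnion>\<^bsub>L\<^esub> y') \<in> \<theta>)"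

definition covers :: "('b, 'c) gorder_scheme \<Rightarrow> 'b \<Rightarrow> 'b \<Rightarrow> bool" where
  "covers L y x \<longleftrightarrow> x \<in> carrier L \<and> y \<in> carrier L \<and> x \<sqsubset>\<^bsub>L\<^esub> y \<and>
     \<not> (\<exists>z \<in> carrier L. x \<sqsubset>\<^bsub>L\<^esub> z \<and> z \<sqsubset>\<^bsub>L\<^esub> y)"

definition join_irreducible :: "('b, 'c) gorder_scheme \<Rightarrow> 'b \<Rightarrow> bool" where
  "join_irreducible L j \<longleftrightarrow> (\<exists>!x. covers L j x)"

definition contracts :: "('b, 'c) gorder_scheme \<Rightarrow> ('b \<times> 'b) set \<Rightarrow> 'b \<Rightarrow> bool" where
  "contracts L \<theta> j \<longleftrightarrow> ((THE x. covers L j x), j) \<in> \<theta>"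

definition transitive_support :: "('a \<times> 'a) set \<Rightarrow> 'a \<Rightarrow> 'a \<Rightarrow> 'a set" where
  "transitive_support A u v = {w. \<exists>p. dipath A p \<and> hd p = u \<and> last p = v \<and> w \<in> set p}"

text \<open>In a rope \<open>(u, v, N, P)\<close>, \<open>N\<close> is the nabla part and \<open>P\<close> the Delta part.\<close>

definition ropes :: "('a \<times> 'a) set \<Rightarrow> ('a \<times> 'a \<times> 'a set \<times> 'a set) set" where
  "ropes A = {(u, v, N, P). (u, v) \<in> A \<and> N \<inter> P = {} \<and>
     N \<union> P = transitive_support A u v - {u, v}}"

definition I_join :: "('a \<times> 'a) set \<Rightarrow> 'a \<times> 'a \<times> 'a set \<times> 'a set \<Rightarrow> ('a \<times> 'a) set" where
  "I_join A = (\<lambda>(u, v, N, P). {(w, w') \<in> A. w \<in> P \<union> {u} \<and> w' \<in> N \<union> {v}})"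

definition coherent_congruence ::
    "('a \<times> 'a) set \<Rightarrow> 'a set \<Rightarrow> 'a set \<Rightarrow> (('a \<times> 'a) set \<times> ('a \<times> 'a) set) set" where
  "coherent_congruence A Mho Omega =
     (THE \<theta>. lattice_congruence (AR A) \<theta> \<and>
        {J. join_irreducible (AR A) J \<and> \<not> contracts (AR A) \<theta> J} =
        {I_join A (u, v, N, P) | u v N P. (u, v, N, P) \<in> ropes A \<and> N \<subseteq> Mho \<and> P \<subseteq> Omega})"

text \<open>In \<open>nabla\<close> and \<open>Delta\<close>, \<open>E\<close> is the arc relation of the reorientation.\<close>

definition nabla :: "('a \<times> 'a) set \<Rightarrow> ('a \<times> 'a) set \<Rightarrow> 'a \<Rightarrow> 'a \<Rightarrow> 'a set" where
  "nabla A E u v = {w. (u, w) \<in> A - E \<and> (w, v) \<in> A \<inter> E}"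

definition Delta :: "('a \<times> 'a) set \<Rightarrow> ('a \<times> 'a) set \<Rightarrow> 'a \<Rightarrow> 'a \<Rightarrow> 'a set" where
  "Delta A E u v = {w. (u, w) \<in> A \<inter> E \<and> (w, v) \<in> A - E}"

definition minimal_in_class :: "('b, 'c) gorder_scheme \<Rightarrow> ('b \<times> 'b) set \<Rightarrow> 'b \<Rightarrow> bool" where
  "minimal_in_class L \<theta> x \<longleftrightarrow> x \<in> carrier L \<and> \<not> (\<exists>y \<in> \<theta> `` {x}. y \<sqsubset>\<^bsub>L\<^esub> x)"

definition maximal_in_class :: "('b, 'c) gorder_scheme \<Rightarrow> ('b \<times> 'b) set \<Rightarrow> 'b \<Rightarrow> bool" where
  "maximal_in_class L \<theta> x \<longleftrightarrow> x \<in> carrier L \<and> \<not> (\<exists>y \<in> \<theta> `` {x}. x \<sqsubset>\<^bsub>L\<^esub> y)"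

end

theory Submission
  imports Defs
begin

text \<open>
  In a skeletal graph, all vertices between the ends of an arc are pairwise adjacent, and a
  shortest directed cycle of a reorientation is a triangle. So a set \<open>R\<close> of arcs is an acyclic
  reorientation iff it is biclosed: for arcs \<open>(a, b)\<close>, \<open>(b, c)\<close>, \<open>(a, c)\<close>, \<open>R\<close> contains
  \<open>(a, c)\<close> if it contains both other arcs, and only if it contains one of them. As in the weak
  order, the join of \<open>R\<close> and \<open>S\<close> is \<open>(R \<union> S)\<^sup>+ \<inter> A\<close>, and \<open>R \<mapsto> A - R\<close> reverses the order.

  The coherent congruence relates \<open>R\<close> and \<open>S\<close> when the same \<open>I_join A (u, v, N, P)\<close> with
  \<open>N \<subseteq> Mho\<close> and \<open>P \<subseteq> Omega\<close> lie below them. This relation respects meets for trivial reasons;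
  it respects joins because complementation turns it into the same relation with \<open>Mho\<close> and
  \<open>Omega\<close> exchanged. That duality also gives the characterization of the maximal elements from
  that of the minimal ones.
\<close>

section \<open>Congruences of finite lattices\<close>

lemma (in partial_order) card_lower_set_less:
  assumes fin: "finite (carrier L)" and x: "x \<in> carrier L" and y: "y \<in> carrier L" and xy: "x \<sqsubset> y"
  shows "card {t \<in> carrier L. t \<sqsubseteq> x} < card {t \<in> carrier L. t \<sqsubseteq> y}"
proof (rule psubset_card_mono)
  have le: "x \<sqsubseteq> y" and ne: "x \<noteq> y" using xy by (simp_all add: lless_eq)
  then have "\<not> y \<sqsubseteq> x" using x y le_antisym[of x y] by metis
  moreover have "t \<sqsubseteq> y" if "t \<in> carrier L" "t \<sqsubseteq> x" for t
    using le_trans[OF that(2) le that(1) x y] .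
  ultimately show "{t \<in> carrier L. t \<sqsubseteq> x} \<subset> {t \<in> carrier L. t \<sqsubseteq> y}" using y by auto
qed (use fin in auto)

text \<open>Among the elements above \<open>w\<close> and strictly below \<open>z\<close>, take one
  with the largest principal ideal; an element strictly between it and \<open>z\<close> would have a
  larger one.\<close>

lemma (in partial_order) exists_covered_above:
  assumes fin: "finite (carrier L)" and w: "w \<in> carrier L" and z: "z \<in> carrier L" and wz: "w \<sqsubset> z"
  obtains c where "covers L z c" and "w \<sqsubseteq> c"
proof -
  let ?P = "\<lambda>c. c \<in> carrier L \<and> w \<sqsubseteq> c \<and> c \<sqsubset> z"
  let ?f = "\<lambda>c. card {t \<in> carrier L. t \<sqsubseteq> c}"
  have "?P w" using w wz by simp
  moreover have "\<forall>y. ?P y \<longrightarrow> ?f y < Suc (card (carrier L))"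
    using fin by (auto simp: less_Suc_eq_le intro: card_mono)
  ultimately have "\<exists>c. ?P c \<and> (\<forall>d. ?P d \<longrightarrow> ?f d \<le> ?f c)"
    by (rule ex_has_greatest_nat)
  then obtain c where max: "?P c \<and> (\<forall>d. ?P d \<longrightarrow> ?f d \<le> ?f c)" ..
  then have c: "?P c" and mx: "\<And>d. ?P d \<Longrightarrow> ?f d \<le> ?f c" by simp_all
  have "\<not> (d \<in> carrier L \<and> c \<sqsubset> d \<and> d \<sqsubset> z)" for d
  proof
    assume d: "d \<in> carrier L \<and> c \<sqsubset> d \<and> d \<sqsubset> z"
    then have "?f c < ?f d" using card_lower_set_less[OF fin, of c d] c by simp
    moreover have "w \<sqsubseteq> d" using le_trans[of w c d] c d w by (simp add: lless_eq)
    then have "?P d" using d by simp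
    ultimately show False using mx[of d] by simp
  qed
  then have "covers L z c" unfolding covers_def using c z by blast
  with c that show thesis by blast
qed

text \<open>Some lower cover of \<open>z\<close> lies above \<open>w\<close>, and \<open>z\<close>
  has only one.\<close>

lemma (in partial_order) le_lower_cover:
  assumes "finite (carrier L)" and "join_irreducible L z" and "w \<in> carrier L" and "w \<sqsubset> z"
  shows "covers L z (THE x. covers L z x) \<and> w \<sqsubseteq> (THE x. covers L z x)"
proof -
  have ex1: "\<exists>!x. covers L z x" using assms(2) by (simp add: join_irreducible_def)
  then have cov: "covers L z (THE x. covers L z x)" by (rule theI')
  then have "z \<in> carrier L" by (simp add: covers_def)
  then obtain c where "covers L z c" "w \<sqsubseteq> c"
    using exists_covered_above assms by blast
  then show ?thesis using ex1 cov by metis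
qed

text \<open>
  If \<open>x\<close> and \<open>y \<ge> x\<close> are congruent for \<open>\<theta>\<^sub>1\<close>, every uncontracted join irreducible below \<open>y\<close> is
  below \<open>x\<close>; the contracted ones can be replaced by their lower cover without changing the
  \<open>\<theta>\<^sub>2\<close>-class of the join with \<open>x\<close>.
\<close>

lemma (in lattice) lattice_congruence_subset:
  assumes fin: "finite (carrier L)"
    and c1: "lattice_congruence L \<theta>\<^sub>1" and c2: "lattice_congruence L \<theta>\<^sub>2"
    and con: "\<And>J. join_irreducible L J \<Longrightarrow> contracts L \<theta>\<^sub>1 J \<Longrightarrow> contracts L \<theta>\<^sub>2 J"
  shows "\<theta>\<^sub>1 \<subseteq> \<theta>\<^sub>2"
proof -
  have e1: "equiv (carrier L) \<theta>\<^sub>1" and e2: "equiv (carrier L) \<theta>\<^sub>2"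
    using c1 c2 by (auto simp: lattice_congruence_def)
  have refl1: "(x, x) \<in> \<theta>\<^sub>1" and refl2: "(x, x) \<in> \<theta>\<^sub>2" if "x \<in> carrier L" for x
    using e1 e2 that by (auto simp: equiv_def refl_on_def)
  have meet1: "(x \<sqinter> y, x' \<sqinter> y') \<in> \<theta>\<^sub>1" and join1: "(x \<squnion> y, x' \<squnion> y') \<in> \<theta>\<^sub>1"
    if "(x, x') \<in> \<theta>\<^sub>1" "(y, y') \<in> \<theta>\<^sub>1" for x x' y y'
    using c1 that by (auto simp: lattice_congruence_def)
  have join2: "(x \<squnion> y, x' \<squnion> y') \<in> \<theta>\<^sub>2" if "(x, x') \<in> \<theta>\<^sub>2" "(y, y') \<in> \<theta>\<^sub>2" for x x' y y'
    using c2 that by (auto simp: lattice_congruence_def)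
  have sym2: "(y, x) \<in> \<theta>\<^sub>2" if "(x, y) \<in> \<theta>\<^sub>2" for x y
    using e2 that by (meson equiv_def symD)
  have trans2: "(x, z) \<in> \<theta>\<^sub>2" if "(x, y) \<in> \<theta>\<^sub>2" "(y, z) \<in> \<theta>\<^sub>2" for x y z
    using e2 that by (meson equiv_def transD)
  have join_eq: "x \<squnion> y = y" if "x \<in> carrier L" "y \<in> carrier L" "x \<sqsubseteq> y" for x y
    using that le_iff_meet by metis
  have meet_eq: "x \<sqinter> y = x" if "x \<in> carrier L" "y \<in> carrier L" "x \<sqsubseteq> y" for x y
    using that le_iff_join by metis
  have le_case: "(y, x) \<in> \<theta>\<^sub>2" if xy: "(x, y) \<in> \<theta>\<^sub>1" and le: "x \<sqsubseteq> y" for x y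
  proof -
    have x: "x \<in> carrier L" and y: "y \<in> carrier L"
      using e1 xy by (auto simp: equiv_def)
    \<comment> \<open>Everything below \<open>y\<close> is absorbed into \<open>x\<close> modulo
      \<open>\<theta>\<^sub>2\<close>, by induction on the size of the principal ideal; the instance
      \<open>z = y\<close> is the goal.\<close>
    have "(x \<squnion> z, x) \<in> \<theta>\<^sub>2" if "z \<in> carrier L" "z \<sqsubseteq> y" for z
      using that
    proof (induction "card {t \<in> carrier L. t \<sqsubseteq> z}" arbitrary: z rule: less_induct)
      case less
      have IH: "(x \<squnion> w, x) \<in> \<theta>\<^sub>2" if w: "w \<in> carrier L" "w \<sqsubset> z" for w
        using less.hyps[of w] card_lower_set_less[OF fin w(1) less.prems(1) w(2)] w
          le_trans[of w z y] less.prems y by (simp add: lless_eq)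
      have z: "z \<in> carrier L" using less.prems by simp
      show ?case
      proof (cases "z \<sqsubseteq> x")
        case True
        then have "x \<squnion> z = x" using x z join_eq join_comm by metis
        then show ?thesis using refl2 x by simp
      next
        case False
        have zx: "z \<sqinter> x \<in> carrier L" using x z by simp
        have "z \<sqinter> x \<noteq> z" using False meet_right[OF z x] by metis
        then have lt: "z \<sqinter> x \<sqsubset> z" using meet_left[OF z x] by (simp add: lless_eq)
        show ?thesis
        proof (cases "join_irreducible L z")
          case True
          define s where "s = (THE t. covers L z t)"
          have cov: "covers L z s" and le_s: "z \<sqinter> x \<sqsubseteq> s"
            using le_lower_cover[OF fin True zx lt] by (auto simp: s_def)
          have s: "s \<in> carrier L" "s \<sqsubset> z" using cov by (auto simp: covers_def)
          \<comment> \<open>Since \<open>z \<sqinter> x \<sqsubseteq> s \<sqsubset> z\<close>,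
            meeting the pair \<open>(x, y)\<close> with \<open>z\<close> and then joining with
            \<open>s\<close> yields \<open>(s, z)\<close>, so \<open>\<theta>\<^sub>1\<close>
            contracts \<open>z\<close>.\<close>
          have "(z \<sqinter> x, z \<sqinter> y) \<in> \<theta>\<^sub>1" using meet1 refl1 xy z by blast
          then have "(z \<sqinter> x, z) \<in> \<theta>\<^sub>1" using meet_eq z y less.prems by simp
          then have "((z \<sqinter> x) \<squnion> s, z \<squnion> s) \<in> \<theta>\<^sub>1" using join1 refl1 s by blast
          moreover have "(z \<sqinter> x) \<squnion> s = s" using join_eq[OF zx s(1) le_s] .
          moreover have "z \<squnion> s = z" using join_eq[OF s(1) z] s(2) by (simp add: join_comm lless_eq)
          ultimately have "contracts L \<theta>\<^sub>1 z" by (simp add: contracts_def s_def)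
          then have "(s, z) \<in> \<theta>\<^sub>2" using con True by (simp add: contracts_def s_def)
          then have "(x \<squnion> s, x \<squnion> z) \<in> \<theta>\<^sub>2" using join2 refl2 x by blast
          then show ?thesis using IH[OF s] sym2 trans2 by metis
        next
          case False
          \<comment> \<open>As \<open>z \<sqinter> x\<close> is strictly below \<open>z\<close>,
            there is a lower cover; without join irreducibility there are two, and their join is
            \<open>z\<close>.\<close>
          obtain a where a: "covers L z a"
            using exists_covered_above[OF fin zx z lt] by blast
          then obtain b where b: "covers L z b" "b \<noteq> a"
            using False unfolding join_irreducible_def by metis
          have ab: "a \<in> carrier L" "a \<sqsubset> z" "b \<in> carrier L" "b \<sqsubset> z"
            using a b by (auto simp: covers_def)
          have le: "a \<squnion> b \<sqsubseteq> z" using join_le[of a z b] ab z by (simp add: lless_eq)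
          have la: "a \<sqsubseteq> a \<squnion> b" and lb: "b \<sqsubseteq> a \<squnion> b"
            using join_left[OF ab(1,3)] join_right[OF ab(1,3)] by auto
          have "a \<squnion> b = z"
          proof (rule ccontr)
            assume "a \<squnion> b \<noteq> z"
            then have lt: "a \<squnion> b \<sqsubset> z" using le by (simp add: lless_eq)
            have "a = a \<squnion> b"
              using a lt la ab lless_eq unfolding covers_def by (metis join_closed)
            moreover have "b = a \<squnion> b"
              using b lt lb ab lless_eq unfolding covers_def by (metis join_closed)
            ultimately show False using b by simp
          qed
          moreover have "((x \<squnion> a) \<squnion> (x \<squnion> b), x \<squnion> x) \<in> \<theta>\<^sub>2" using join2 IH ab by blast
          moreover have "x \<squnion> x = x" using join_eq x by simp
          moreover have "(x \<squnion> a) \<squnion> (x \<squnion> b) = x \<squnion> (a \<squnion> b)"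
          proof -
            let ?l = "(x \<squnion> a) \<squnion> (x \<squnion> b)" and ?r = "x \<squnion> (a \<squnion> b)"
            have cl: "x \<squnion> a \<in> carrier L" "x \<squnion> b \<in> carrier L" "a \<squnion> b \<in> carrier L"
              "?l \<in> carrier L" "?r \<in> carrier L"
              using x ab by simp_all
            have l: "x \<squnion> a \<sqsubseteq> ?l" "x \<squnion> b \<sqsubseteq> ?l"
              using join_left[OF cl(1,2)] join_right[OF cl(1,2)] .
            have r: "x \<sqsubseteq> ?r" "a \<squnion> b \<sqsubseteq> ?r"
              using join_left[OF x cl(3)] join_right[OF x cl(3)] .
            have ar: "a \<sqsubseteq> ?r" using le_trans[OF la r(2) ab(1) cl(3,5)] .
            have br: "b \<sqsubseteq> ?r" using le_trans[OF lb r(2) ab(3) cl(3,5)] .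
            have xl: "x \<sqsubseteq> ?l" using le_trans[OF join_left[OF x ab(1)] l(1) x cl(1,4)] .
            have al: "a \<sqsubseteq> ?l" using le_trans[OF join_right[OF x ab(1)] l(1) ab(1) cl(1,4)] .
            have bl: "b \<sqsubseteq> ?l" using le_trans[OF join_right[OF x ab(3)] l(2) ab(3) cl(2,4)] .
            have "?l \<sqsubseteq> ?r"
              using join_le[OF join_le[OF r(1) ar x ab(1) cl(5)] join_le[OF r(1) br x ab(3) cl(5)] cl(1,2,5)] .
            moreover have "?r \<sqsubseteq> ?l"
              using join_le[OF xl join_le[OF al bl ab(1,3) cl(4)] x cl(3,4)] .
            ultimately show ?thesis using le_antisym[OF _ _ cl(4,5)] by metis
          qed
          ultimately show ?thesis by simp
        qed
      qed
    qed
    from this[of y] show ?thesis using y join_eq[OF x y le] by simp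
  qed
  show ?thesis
  proof (rule subsetI)
    fix p assume "p \<in> \<theta>\<^sub>1"
    then obtain x y where p: "p = (x, y)" and xy: "(x, y) \<in> \<theta>\<^sub>1" by (cases p) auto
    have x: "x \<in> carrier L" and y: "y \<in> carrier L" using e1 xy by (auto simp: equiv_def)
    \<comment> \<open>An arbitrary pair reduces to two comparable ones through
      \<open>x \<sqinter> y\<close>.\<close>
    have idem: "t \<sqinter> t = t" if "t \<in> carrier L" for t using meet_eq that by simp
    have "(x \<sqinter> y, y) \<in> \<theta>\<^sub>1" using meet1[OF xy refl1[OF y]] idem[OF y] by simp
    then have 1: "(y, x \<sqinter> y) \<in> \<theta>\<^sub>2" using le_case meet_right[OF x y] by metis
    have "(x, x \<sqinter> y) \<in> \<theta>\<^sub>1" using meet1[OF refl1[OF x] xy] idem[OF x] by simp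
    then have "(x \<sqinter> y, x) \<in> \<theta>\<^sub>1" using e1 by (meson equiv_def symD)
    then have "(x, x \<sqinter> y) \<in> \<theta>\<^sub>2" using le_case meet_left[OF x y] by metis
    then show "p \<in> \<theta>\<^sub>2" using 1 p sym2 trans2 by metis
  qed
qed

text \<open>This provides the uniqueness behind the \<open>THE\<close> in
  \<open>coherent_congruence\<close>.\<close>

lemma (in lattice) lattice_congruence_eqI:
  assumes "finite (carrier L)"
    and "lattice_congruence L \<theta>\<^sub>1" and "lattice_congruence L \<theta>\<^sub>2"
    and "{J. join_irreducible L J \<and> \<not> contracts L \<theta>\<^sub>1 J} =
         {J. join_irreducible L J \<and> \<not> contracts L \<theta>\<^sub>2 J}"
  shows "\<theta>\<^sub>1 = \<theta>\<^sub>2"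
  using lattice_congruence_subset[of \<theta>\<^sub>1 \<theta>\<^sub>2] lattice_congruence_subset[of \<theta>\<^sub>2 \<theta>\<^sub>1] assms by blast

section \<open>Directed paths in skeletal graphs\<close>

lemma successively_imp_trancl:
  assumes "successively (\<lambda>x y. (x, y) \<in> r) p" and "i < j" and "j < length p"
  shows "(p ! i, p ! j) \<in> r\<^sup>+"
  using assms(2,3)
proof (induction j)
  case (Suc j)
  have step: "(p ! j, p ! Suc j) \<in> r"
    using assms(1) Suc.prems by (simp add: successively_conv_nth)
  show ?case
  proof (cases "i = j")
    case False
    then have "(p ! i, p ! j) \<in> r\<^sup>+" using Suc by simp
    then show ?thesis using step by (rule trancl_into_trancl)
  qed (use step in auto)
qed simp

lemma acyclic_imp_dipath:
  assumes "acyclic r" and "p \<noteq> []" and "successively (\<lambda>x y. (x, y) \<in> r) p"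
  shows "dipath r p"
proof -
  have "distinct p"
    unfolding distinct_conv_nth
    using successively_imp_trancl[OF assms(3)] assms(1)
    by (metis acyclic_def linorder_neqE_nat)
  then show ?thesis using assms by (simp add: dipath_def)
qed

text \<open>Keeping the endpoint outside \<open>p\<close> allows gluing walks at \<open>y\<close>;
  for \<open>y = a\<close>, \<open>p\<close> itself is a closed walk listed without its final
  return.\<close>

lemma trancl_imp_path_to:
  assumes "(a, y) \<in> r\<^sup>+"
  shows "\<exists>p. p \<noteq> [] \<and> hd p = a \<and> successively (\<lambda>x y. (x, y) \<in> r) (p @ [y])"
  using assms
proof (induction rule: trancl_induct)
  case (base y)
  then show ?case by (intro exI[of _ "[a]"]) simp
next
  case (step y z)
  then obtain p where "p \<noteq> []" "hd p = a" "successively (\<lambda>x y. (x, y) \<in> r) (p @ [y])" by blast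
  then show ?case using step by (intro exI[of _ "p @ [y]"]) (simp add: successively_append_iff)
qed

lemma trancl_imp_path_from:
  assumes "(y, c) \<in> r\<^sup>+"
  shows "\<exists>q. q \<noteq> [] \<and> last q = c \<and> successively (\<lambda>x y. (x, y) \<in> r) (y # q)"
  using assms
proof (induction rule: converse_trancl_induct)
  case (base y)
  then show ?case by (intro exI[of _ "[c]"]) simp
next
  case (step y z)
  then obtain q where "q \<noteq> []" "last q = c" "successively (\<lambda>x y. (x, y) \<in> r) (z # q)" by blast
  then show ?case using step by (intro exI[of _ "z # q"]) simp
qed

text \<open>The rank counts strict predecessors. Rank differences serve as lengths of arcs in later
  inductions: both parts of a subdivided arc are shorter.\<close>

lemma finite_acyclic_rank:
  assumes "finite r" and "acyclic r"
  obtains f :: "'a \<Rightarrow> nat" where "\<And>a b. (a, b) \<in> r \<Longrightarrow> f a < f b"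
proof -
  define f where "f x = card {y. (y, x) \<in> r\<^sup>+}" for x
  have "f a < f b" if ab: "(a, b) \<in> r" for a b
  proof -
    have "finite {y. (y, b) \<in> r\<^sup>+}"
      by (rule finite_subset[of _ "Domain r"]) (use assms in \<open>auto intro: finite_Domain dest: tranclD\<close>)
    moreover have "{y. (y, a) \<in> r\<^sup>+} \<subset> {y. (y, b) \<in> r\<^sup>+}"
      using ab assms(2) by (auto simp: acyclic_def)
    ultimately show ?thesis unfolding f_def by (rule psubset_card_mono)
  qed
  then show thesis using that by blast
qed

locale skeletal_dag =
  fixes V :: "'a set" and A :: "('a \<times> 'a) set"
  assumes dag: "dag V A" and skeletal: "skeletal V A"
begin

lemma acyclic_A: "acyclic A"
  using dag by (simp add: dag_def)

lemma A_subset: "A \<subseteq> V \<times> V"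
  using dag by (simp add: dag_def)

lemma finite_A: "finite A"
  using dag by (auto simp: dag_def intro: finite_subset)

lemma A_irrefl: "(a, a) \<notin> A"
  using acyclic_A by (auto simp: acyclic_def)

lemma A_asym: "(a, b) \<in> A \<Longrightarrow> (b, a) \<notin> A"
  using acyclic_A by (meson acyclic_def trancl.simps)

lemma A_no_triangle: "(a, b) \<in> A \<Longrightarrow> (b, c) \<in> A \<Longrightarrow> (c, a) \<notin> A"
  using acyclic_A by (meson acyclic_def trancl.simps)

text \<open>By acyclicity the concatenated walk through \<open>y\<close> is a path, so
  \<open>filled\<close> applies to it. All later appeals to \<open>filled\<close> go through this
  form.\<close>

lemma filled_trancl:
  assumes "(a, y) \<in> A\<^sup>+" and "(y, c) \<in> A\<^sup>+" and ac: "(a, c) \<in> A"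
  shows "(a, y) \<in> A \<and> (y, c) \<in> A"
proof -
  obtain p where p: "p \<noteq> []" "hd p = a" "successively (\<lambda>x y. (x, y) \<in> A) (p @ [y])"
    using trancl_imp_path_to assms(1) by metis
  obtain q where q: "q \<noteq> []" "last q = c" "successively (\<lambda>x y. (x, y) \<in> A) (y # q)"
    using trancl_imp_path_from assms(2) by metis
  let ?l = "p @ y # q"
  have "successively (\<lambda>x y. (x, y) \<in> A) ?l"
    using p q by (auto simp: successively_append_iff)
  then have "dipath A ?l" using acyclic_imp_dipath[OF acyclic_A] by simp
  moreover have "(hd ?l, last ?l) \<in> A" using p q ac by simp
  ultimately have all: "(?l ! i, ?l ! j) \<in> A" if "i < j" "j < length ?l" for i j
    using skeletal that unfolding skeletal_def filled_def by blast
  have 0: "?l ! 0 = a" using p by (simp add: nth_append hd_conv_nth)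
  have 1: "?l ! length p = y" by simp
  have 2: "?l ! (length p + length q) = c"
    using q by (simp add: nth_append last_conv_nth nth_Cons')
  show ?thesis
    using all[of 0 "length p"] all[of "length p" "length p + length q"] p q
    unfolding 0 1 2 by simp
qed

lemma filled4:
  assumes "(a, b) \<in> A" and "(b, c) \<in> A" and "(c, d) \<in> A" and "(a, d) \<in> A"
  shows "(a, c) \<in> A \<and> (b, d) \<in> A"
  using filled_trancl[of a b d] filled_trancl[of a c d] assms
  by (meson r_into_trancl trancl_into_trancl)

text \<open>If a longer path existed, \<open>filled\<close> would join its second vertex to
  \<open>y\<close>; so it suffices to exclude detours with one intermediate vertex.\<close>

lemma transitive_reduction_RestrI:
  assumes xy: "(x, y) \<in> A" and U: "x \<in> U" "y \<in> U"
    and no: "\<And>z. z \<in> U \<Longrightarrow> (x, z) \<in> A \<Longrightarrow> (z, y) \<in> A \<Longrightarrow> False"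
  shows "(x, y) \<in> transitive_reduction (Restr A U)"
proof -
  have False if p: "dipath (Restr A U) p" "hd p = x" "last p = y" "length p \<ge> 3" for p
  proof -
    have suc: "successively (\<lambda>x y. (x, y) \<in> A) p"
      using p(1) unfolding dipath_def by (auto elim: successively_mono)
    have "(p ! 0, p ! 1) \<in> Restr A U"
      using p unfolding dipath_def by (auto simp: successively_conv_nth)
    moreover have "p ! 0 = x" "p ! (length p - 1) = y"
      using p by (auto simp: dipath_def hd_conv_nth last_conv_nth)
    moreover have "(p ! 1, p ! (length p - 1)) \<in> A\<^sup>+"
      by (rule successively_imp_trancl[OF suc]) (use p in auto)
    ultimately show False
      using no[of "p ! 1"] filled_trancl[of x "p ! 1" y] xy by auto
  qed
  then show ?thesis using xy U by (auto simp: transitive_reduction_def)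
qed

text \<open>If \<open>b\<close> and \<open>b'\<close> were distinct and not adjacent, no side of the
  quadrilateral \<open>a, b, c, b'\<close> would have a detour inside it, so all four would survive
  in the transitive reduction of the induced subgraph and form a cycle.\<close>

lemma between_comparable:
  assumes arcs: "(a, b) \<in> A" "(b, c) \<in> A" "(a, b') \<in> A" "(b', c) \<in> A"
  shows "b = b' \<or> (b, b') \<in> A \<or> (b', b) \<in> A"
proof (rule ccontr)
  assume neg: "\<not> ?thesis"
  let ?U = "{a, b, b', c}"
  let ?T = "transitive_reduction (Restr A ?U)"
  have ne: "a \<noteq> b" "b \<noteq> c" "a \<noteq> b'" "b' \<noteq> c" "a \<noteq> c"
    using arcs A_irrefl A_asym by blast+
  have "(a, b) \<in> ?T" "(b, c) \<in> ?T" "(a, b') \<in> ?T" "(b', c) \<in> ?T"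
    by (rule transitive_reduction_RestrI; use arcs neg A_irrefl A_asym in blast)+
  then have "dipath (?T \<union> ?T\<inverse>) [a, b, c, b'] \<and> (last [a, b, c, b'], hd [a, b, c, b']) \<in> ?T \<union> ?T\<inverse>"
    using ne neg by (auto simp: dipath_def)
  then have "\<not> forest ?T" unfolding forest_def by (intro notI) force
  moreover have "?U \<subseteq> V" using A_subset arcs by blast
  ultimately show False using skeletal unfolding skeletal_def vertebrate_def by blast
qed

text \<open>A chordless cycle with at least four vertices spans no triangle, so the transitive
  reduction of its induced subgraph keeps the whole cycle, against \<open>vertebrate\<close>. The
  excluded index pairs are the sides of the cycle, including the closing one.\<close>

lemma chordal:
  assumes c: "dipath (A \<union> A\<inverse>) c" "length c \<ge> 4" and last: "(last c, hd c) \<in> A \<union> A\<inverse>"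
  shows "\<exists>i j. i < j \<and> j < length c \<and> (c ! i, c ! j) \<in> A \<union> A\<inverse> \<and>
           j \<noteq> Suc i \<and> \<not> (i = 0 \<and> j = length c - 1)"
proof (rule ccontr)
  let ?G = "A \<union> A\<inverse>" let ?n = "length c"
  let ?T = "transitive_reduction (Restr A (set c))"
  assume "\<not> ?thesis"
  then have chordless: "j = Suc i \<or> i = 0 \<and> j = ?n - 1"
    if "i < j" "j < ?n" "(c ! i, c ! j) \<in> ?G" for i j
    using that by blast
  have adj: "j = Suc i \<or> i = Suc j \<or> i = 0 \<and> j = ?n - 1 \<or> j = 0 \<and> i = ?n - 1"
    if "i < ?n" "j < ?n" "(c ! i, c ! j) \<in> ?G" for i j
  proof -
    have "i \<noteq> j" using that A_irrefl by auto
    then consider "i < j" | "j < i" by linarith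
    then show ?thesis
    proof cases
      case 1 then show ?thesis using chordless[of i j] that by auto
    next
      case 2
      moreover have "(c ! j, c ! i) \<in> ?G" using that by auto
      ultimately show ?thesis using chordless[of j i] that by auto
    qed
  qed
  \<comment> \<open>A detour through \<open>z\<close> would make three positions pairwise neighbours
    on a cycle with at least four vertices.\<close>
  have T: "(x, y) \<in> ?T" if xy: "(x, y) \<in> A" "x \<in> set c" "y \<in> set c" for x y
  proof (rule transitive_reduction_RestrI[OF xy])
    fix z assume z: "z \<in> set c" "(x, z) \<in> A" "(z, y) \<in> A"
    obtain i j k where ijk: "i < ?n" "j < ?n" "k < ?n" "x = c ! i" "y = c ! j" "z = c ! k"
      using xy z by (metis in_set_conv_nth)
    then have "i \<noteq> j" "j \<noteq> k" "i \<noteq> k" using xy z A_irrefl by auto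
    moreover have "j = Suc i \<or> i = Suc j \<or> i = 0 \<and> j = ?n - 1 \<or> j = 0 \<and> i = ?n - 1"
      using adj[of i j] ijk xy by blast
    moreover have "j = Suc k \<or> k = Suc j \<or> k = 0 \<and> j = ?n - 1 \<or> j = 0 \<and> k = ?n - 1"
      using adj[of k j] ijk z by blast
    moreover have "k = Suc i \<or> i = Suc k \<or> i = 0 \<and> k = ?n - 1 \<or> k = 0 \<and> i = ?n - 1"
      using adj[of i k] ijk z by blast
    ultimately show False using c(2) ijk(1-3) by linarith
  qed
  have TG: "(x, y) \<in> ?T \<union> ?T\<inverse>" if "(x, y) \<in> ?G" "x \<in> set c" "y \<in> set c" for x y
    using that T by auto
  have "successively (\<lambda>x y. (x, y) \<in> ?G) c" using c by (simp add: dipath_def)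
  then have "successively (\<lambda>x y. (x, y) \<in> ?T \<union> ?T\<inverse>) c"
    unfolding successively_conv_nth using TG by (meson Suc_lessD nth_mem)
  then have "dipath (?T \<union> ?T\<inverse>) c" using c by (simp add: dipath_def)
  moreover have "(last c, hd c) \<in> ?T \<union> ?T\<inverse>" using TG last c by (simp add: dipath_def)
  ultimately have "\<not> forest ?T" unfolding forest_def using c(2) by (intro notI) force
  moreover have "set c \<subseteq> V"
  proof
    fix x assume "x \<in> set c"
    then obtain i where i: "i < ?n" "x = c ! i" by (metis in_set_conv_nth)
    show "x \<in> V"
    proof (cases "Suc i < ?n")
      case True
      then have "(x, c ! Suc i) \<in> ?G" using c i by (simp add: dipath_def successively_conv_nth)
      then show ?thesis using A_subset by auto
    next
      case False
      then have "Suc i = ?n" using i by simp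
      then have "?n - 1 = i" by simp
      then have "x = last c" using i c last_conv_nth[of c] by (simp add: dipath_def)
      then show ?thesis using last A_subset by auto
    qed
  qed
  ultimately show False using skeletal unfolding skeletal_def vertebrate_def by blast
qed

end

section \<open>Acyclic reorientations as biclosed sets\<close>

text \<open>When \<open>A\<close> is a finite strict linear order, these are the inversion sets of
  permutations.\<close>

definition biclosed :: "('a \<times> 'a) set \<Rightarrow> ('a \<times> 'a) set \<Rightarrow> bool" where
  "biclosed A R \<longleftrightarrow> R \<subseteq> A \<and>
     (\<forall>a b c. (a, b) \<in> A \<longrightarrow> (b, c) \<in> A \<longrightarrow> (a, c) \<in> A \<longrightarrow>
        ((a, b) \<in> R \<longrightarrow> (b, c) \<in> R \<longrightarrow> (a, c) \<in> R) \<and>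
        ((a, c) \<in> R \<longrightarrow> (a, b) \<in> R \<or> (b, c) \<in> R))"

lemma biclosed_subset: "biclosed A R \<Longrightarrow> R \<subseteq> A"
  by (simp add: biclosed_def)

lemma biclosed_closed:
  "biclosed A R \<Longrightarrow> (a, b) \<in> R \<Longrightarrow> (b, c) \<in> R \<Longrightarrow> (a, c) \<in> A \<Longrightarrow> (a, c) \<in> R"
  unfolding biclosed_def by blast

lemma biclosed_coclosed:
  "biclosed A R \<Longrightarrow> (a, c) \<in> R \<Longrightarrow> (a, b) \<in> A \<Longrightarrow> (b, c) \<in> A \<Longrightarrow> (a, b) \<in> R \<or> (b, c) \<in> R"
  unfolding biclosed_def by blast

lemma biclosedI:
  assumes "R \<subseteq> A"
    and "\<And>a b c. (a, b) \<in> R \<Longrightarrow> (b, c) \<in> R \<Longrightarrow> (a, c) \<in> A \<Longrightarrow> (a, c) \<in> R"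
    and "\<And>a b c. (a, c) \<in> R \<Longrightarrow> (a, b) \<in> A \<Longrightarrow> (b, c) \<in> A \<Longrightarrow> (a, b) \<notin> R \<Longrightarrow> (b, c) \<in> R"
  shows "biclosed A R"
  unfolding biclosed_def using assms by blast

lemma biclosed_Diff: "biclosed A R \<Longrightarrow> biclosed A (A - R)"
  unfolding biclosed_def by blast

context skeletal_dag
begin

lemma reorient_arc:
  assumes "R \<subseteq> A" and "(x, y) \<in> A"
  shows "(x, y) \<in> reorient A R \<longleftrightarrow> (x, y) \<notin> R" and "(y, x) \<in> reorient A R \<longleftrightarrow> (x, y) \<in> R"
  using assms A_asym by (auto simp: reorient_def)

lemma reorient_adjacent: "R \<subseteq> A \<Longrightarrow> (x, y) \<in> reorient A R \<Longrightarrow> (x, y) \<in> A \<union> A\<inverse>"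
  by (auto simp: reorient_def)

lemma reorient_asym: "R \<subseteq> A \<Longrightarrow> (x, y) \<in> reorient A R \<Longrightarrow> (y, x) \<notin> reorient A R"
  using A_asym by (auto simp: reorient_def)

lemma reorient_total: "(x, y) \<in> A \<union> A\<inverse> \<Longrightarrow> (x, y) \<in> reorient A R \<or> (y, x) \<in> reorient A R"
  by (auto simp: reorient_def)

lemma finite_reorient: "R \<subseteq> A \<Longrightarrow> finite (reorient A R)"
  using finite_A by (auto simp: reorient_def intro: finite_subset)

text \<open>A shortest directed cycle of a reorientation has no chord, hence is a triangle.\<close>

lemma directed_cycle_imp_triangle:
  assumes R: "R \<subseteq> A" and c: "c \<noteq> []" "successively (\<lambda>x y. (x, y) \<in> reorient A R) c"
    "(last c, hd c) \<in> reorient A R"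
  shows "\<exists>a b d. (a, b) \<in> reorient A R \<and> (b, d) \<in> reorient A R \<and> (d, a) \<in> reorient A R"
  using c
proof (induction "length c" arbitrary: c rule: less_induct)
  case less
  let ?E = "reorient A R" and ?n = "length c"
  let ?suc = "successively (\<lambda>x y. (x, y) \<in> ?E)"
  show ?case
  proof (cases "distinct c")
    case False
    \<comment> \<open>Two occurrences of \<open>y\<close> delimit a shorter closed walk.\<close>
    then obtain xs y ys zs where c: "c = xs @ [y] @ ys @ [y] @ zs"
      using not_distinct_decomp by blast
    have "c = xs @ ((y # ys) @ [y]) @ zs" using c by simp
    then have "?suc ((y # ys) @ [y])"
      using less.prems(2) by (metis successively_append_iff)
    then have "?suc (y # ys)" "(last (y # ys), y) \<in> ?E"
      unfolding successively_append_iff by simp_all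
    then show ?thesis using less.hyps[of "y # ys"] c by simp
  next
    case True
    have "?n \<noteq> 0" using less.prems(1) by simp
    then consider "?n = 1" | "?n = 2" | "?n = 3" | "?n \<ge> 4" by linarith
    then show ?thesis
    proof cases
      case 1
      then have "hd c = last c" by (cases c) auto
      then show ?thesis using less.prems(3) reorient_asym[OF R] by metis
    next
      case 2
      then obtain x y where "c = [x, y]" by (auto simp: numeral_2_eq_2 length_Suc_conv)
      then show ?thesis using less.prems reorient_asym[OF R] by auto
    next
      case 3
      then obtain x y z where "c = [x, y, z]" by (auto simp: numeral_3_eq_3 length_Suc_conv)
      then show ?thesis using less.prems by auto
    next
      case 4
      have "successively (\<lambda>x y. (x, y) \<in> A \<union> A\<inverse>) c"
        using less.prems(2) reorient_adjacent[OF R] unfolding successively_conv_nth by blast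
      then have "dipath (A \<union> A\<inverse>) c" using less.prems True by (simp add: dipath_def)
      then obtain i j where ij: "i < j" "j < ?n" "(c ! i, c ! j) \<in> A \<union> A\<inverse>"
        "j \<noteq> Suc i" "\<not> (i = 0 \<and> j = ?n - 1)"
        using chordal[of c] 4 reorient_adjacent[OF R less.prems(3)] by blast
      from reorient_total[OF ij(3)] show ?thesis
      proof
        \<comment> \<open>A forward chord bypasses the vertices strictly between positions
          \<open>i\<close> and \<open>j\<close>; there are some because
          \<open>j \<noteq> Suc i\<close>.\<close>
        assume chord: "(c ! i, c ! j) \<in> ?E"
        let ?c = "take (Suc i) c @ drop j c"
        have "?suc (take (Suc i) c)" "?suc (drop j c)"
          using less.prems(2) by (metis append_take_drop_id successively_append_iff)+
        moreover have "last (take (Suc i) c) = c ! i" "hd (drop j c) = c ! j"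
          using ij by (simp_all add: take_Suc_conv_app_nth hd_drop_conv_nth)
        ultimately have "?suc ?c" using chord by (simp add: successively_append_iff)
        moreover have "last ?c = last c" "hd ?c = hd c" using ij less.prems by simp_all
        moreover have "length ?c < ?n" using ij by auto
        ultimately show ?thesis using less.hyps[of ?c] less.prems by simp
      next
        \<comment> \<open>A backward chord closes the segment from \<open>i\<close> to
          \<open>j\<close>, which is shorter because it is not all of \<open>c\<close>.\<close>
        assume chord: "(c ! j, c ! i) \<in> ?E"
        let ?c = "drop i (take (Suc j) c)"
        have "?suc (take (Suc j) c)"
          using less.prems(2) by (metis append_take_drop_id successively_append_iff)
        then have "?suc ?c" by (metis append_take_drop_id successively_append_iff)
        moreover have "last ?c = c ! j" "hd ?c = c ! i"
          using ij by (simp_all add: take_Suc_conv_app_nth hd_drop_conv_nth nth_append)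
        moreover have "length ?c < ?n" using ij by auto
        ultimately show ?thesis using less.hyps[of ?c] chord ij by simp
      qed
    qed
  qed
qed

text \<open>Violations of biclosedness are directed triangles of the reorientation, and a directed
  cycle can always be shortened to a triangle.\<close>

lemma acyclic_reorientations_iff: "R \<in> acyclic_reorientations A \<longleftrightarrow> biclosed A R"
proof
  let ?E = "reorient A R"
  assume "R \<in> acyclic_reorientations A"
  then have R: "R \<subseteq> A" and ac: "acyclic ?E" by (auto simp: acyclic_reorientations_def)
  have tri: False if "(a, b) \<in> ?E" "(b, c) \<in> ?E" "(c, a) \<in> ?E" for a b c
    using ac that by (meson acyclic_def trancl.simps)
  show "biclosed A R"
  proof (rule biclosedI[OF R])
    fix a b c assume "(a, b) \<in> R" "(b, c) \<in> R" "(a, c) \<in> A"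
    then show "(a, c) \<in> R" using tri[of a c b] R by (auto simp: reorient_def)
  next
    fix a b c assume "(a, c) \<in> R" "(a, b) \<in> A" "(b, c) \<in> A" "(a, b) \<notin> R"
    then show "(b, c) \<in> R" using tri[of a b c] by (auto simp: reorient_def)
  qed
next
  let ?E = "reorient A R"
  assume bi: "biclosed A R"
  have R: "R \<subseteq> A" using bi by (rule biclosed_subset)
  have "False" if cyc: "(x, x) \<in> ?E\<^sup>+" for x
  proof -
    obtain p where p: "p \<noteq> []" "hd p = x" "successively (\<lambda>x y. (x, y) \<in> ?E) (p @ [x])"
      using trancl_imp_path_to[OF cyc] by blast
    then have "successively (\<lambda>x y. (x, y) \<in> ?E) p" "(last p, hd p) \<in> ?E"
      by (simp_all add: successively_append_iff)
    then obtain a b d where abd: "(a, b) \<in> ?E" "(b, d) \<in> ?E" "(d, a) \<in> ?E"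
      using directed_cycle_imp_triangle[OF R p(1)] by blast
    \<comment> \<open>If none or all of the three arcs are reversed, \<open>A\<close> contains a
      directed triangle; one reversed arc violates coclosedness and two violate closedness.\<close>
    have "(s, t) \<in> A \<and> (s, t) \<notin> R \<or> (t, s) \<in> A \<and> (t, s) \<in> R" if "(s, t) \<in> ?E" for s t
      using that R by (auto simp: reorient_def)
    from this[OF abd(1)] this[OF abd(2)] this[OF abd(3)] show False
      using bi A_no_triangle unfolding biclosed_def by metis
  qed
  then show "R \<in> acyclic_reorientations A"
    using R by (auto simp: acyclic_reorientations_def acyclic_def)
qed

text \<open>If a longer path joined \<open>x\<close> to \<open>y\<close>, flipping \<open>(x, y)\<close> would create a directed triangle.\<close>

lemma transitive_reduction_reorient:
  assumes R: "R \<subseteq> A" and ac: "acyclic (reorient A R)"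
  shows "(x, y) \<in> transitive_reduction (reorient A R) \<longleftrightarrow>
    (x, y) \<in> reorient A R \<and> \<not> (\<exists>z. (x, z) \<in> reorient A R \<and> (z, y) \<in> reorient A R)"
proof -
  let ?E = "reorient A R"
  have tri: False if "(a, b) \<in> ?E" "(b, c) \<in> ?E" "(c, a) \<in> ?E" for a b c
    using ac that by (meson acyclic_def trancl.simps)
  have 1: "\<exists>p. dipath ?E p \<and> hd p = x \<and> last p = y \<and> length p \<ge> 3"
    if "(x, z) \<in> ?E" "(z, y) \<in> ?E" for z
    using that acyclic_imp_dipath[OF ac, of "[x, z, y]"] by (intro exI[of _ "[x, z, y]"]) simp
  have 2: "\<exists>z. (x, z) \<in> ?E \<and> (z, y) \<in> ?E"
    if xy: "(x, y) \<in> ?E" and p: "dipath ?E p" "hd p = x" "last p = y" "length p \<ge> 3" for p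
  proof -
    \<comment> \<open>\<open>R'\<close> toggles the arc of \<open>A\<close> joining \<open>x\<close>
      and \<open>y\<close>, whichever its direction, so that \<open>?E'\<close> is \<open>?E\<close>
      with \<open>(x, y)\<close> flipped.\<close>
    define R' where "R' = (if (x, y) \<in> A then insert (x, y) R else R - {(y, x)})"
    let ?E' = "reorient A R'"
    have R': "R' \<subseteq> A" using R by (auto simp: R'_def)
    have E': "?E' = insert (y, x) (?E - {(x, y)})"
    proof (cases "(x, y) \<in> A")
      case True
      then have "(x, y) \<notin> R" using xy reorient_arc(1)[OF R] by simp
      then show ?thesis using True R A_asym A_irrefl unfolding R'_def reorient_def by auto
    next
      case False
      then have "(y, x) \<in> R" using xy by (auto simp: reorient_def)
      then show ?thesis using False R A_asym A_irrefl unfolding R'_def reorient_def by auto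
    qed
    have "(p ! i, p ! Suc i) \<in> ?E'" if i: "Suc i < length p" for i
    proof -
      have "(p ! i, p ! Suc i) \<in> ?E"
        using p(1) i by (simp add: dipath_def successively_conv_nth)
      \<comment> \<open>The vertices of \<open>p\<close> are distinct, so \<open>x\<close> occurs
        only first and \<open>y\<close> only last, and at least one vertex separates them.\<close>
      moreover have "(p ! i, p ! Suc i) \<noteq> (x, y)"
      proof
        assume eq: "(p ! i, p ! Suc i) = (x, y)"
        have "p ! 0 = x" "p ! (length p - 1) = y"
          using p by (auto simp: dipath_def hd_conv_nth last_conv_nth)
        then have "i = 0" "Suc i = length p - 1"
          using p(1) eq i nth_eq_iff_index_eq[of p i 0] nth_eq_iff_index_eq[of p "Suc i" "length p - 1"]
          by (auto simp: dipath_def)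
        then show False using p(4) by simp
      qed
      ultimately show ?thesis using E' by simp
    qed
    then have "successively (\<lambda>x y. (x, y) \<in> ?E') p" by (simp add: successively_conv_nth)
    moreover have "(last p, hd p) \<in> ?E'" using p E' by simp
    ultimately obtain a b d where abd: "(a, b) \<in> ?E'" "(b, d) \<in> ?E'" "(d, a) \<in> ?E'"
      using directed_cycle_imp_triangle[OF R'] p(1) unfolding dipath_def by blast
    \<comment> \<open>As \<open>?E\<close> has no directed triangle, the one found uses
      \<open>(y, x)\<close>; since \<open>x \<noteq> y\<close>, its other two sides lie in
      \<open>?E\<close> and meet at the required \<open>z\<close>.\<close>
    have "x \<noteq> y" using xy reorient_asym[OF R] by blast
    then show ?thesis using abd tri[of a b d] unfolding E' by auto
  qed
  show ?thesis using 1 2 by (auto simp: transitive_reduction_def)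
qed

section \<open>The lattice of acyclic reorientations\<close>

lemma AR_simps [simp]:
  "carrier (AR A) = acyclic_reorientations A"
  "x \<sqsubseteq>\<^bsub>AR A\<^esub> y \<longleftrightarrow> x \<subseteq> y"
  "x .=\<^bsub>AR A\<^esub> y \<longleftrightarrow> x = y"
  "x \<sqsubset>\<^bsub>AR A\<^esub> y \<longleftrightarrow> x \<subset> y"
  by (auto simp: AR_def lless_def)

text \<open>Let \<open>(y, c)\<close> be the last step of the walk. Both \<open>b\<close> and
  \<open>y\<close> lie between \<open>a\<close> and \<open>c\<close>, hence are comparable: if
  \<open>b\<close> precedes \<open>y\<close>, the induction hypothesis splits \<open>(a, y)\<close>;
  if \<open>b\<close> follows \<open>y\<close>, coclosedness of \<open>R\<close> or \<open>S\<close>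
  splits \<open>(y, c)\<close>.\<close>

lemma trancl_Un_coclosed:
  assumes R: "biclosed A R" and S: "biclosed A S"
    and ac: "(a, c) \<in> (R \<union> S)\<^sup>+" and "(a, c) \<in> A" "(a, b) \<in> A" "(b, c) \<in> A"
  shows "(a, b) \<in> (R \<union> S)\<^sup>+ \<or> (b, c) \<in> (R \<union> S)\<^sup>+"
  using ac assms(4-6)
proof (induction arbitrary: b rule: trancl_induct)
  case (base c)
  then show ?case using biclosed_coclosed[OF R] biclosed_coclosed[OF S] by blast
next
  case (step y c)
  have sub: "R \<union> S \<subseteq> A" using R S biclosed_subset by blast
  have "(a, y) \<in> A\<^sup>+" using step.hyps(1) sub trancl_mono_subset by blast
  moreover have yc: "(y, c) \<in> A" using step.hyps(2) sub by blast
  ultimately have ay: "(a, y) \<in> A" using filled_trancl[of a y c] step.prems by blast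
  from between_comparable[OF \<open>(a, b) \<in> A\<close> \<open>(b, c) \<in> A\<close> ay yc]
  consider "b = y" | "(b, y) \<in> A" | "(y, b) \<in> A" by blast
  then show ?case
  proof cases
    case 1
    then show ?thesis using step.hyps by blast
  next
    case 2
    then have "(a, b) \<in> (R \<union> S)\<^sup>+ \<or> (b, y) \<in> (R \<union> S)\<^sup>+" using step.IH ay step.prems by blast
    then show ?thesis using step.hyps(2) trancl_into_trancl by metis
  next
    case 3
    then have "(y, b) \<in> R \<union> S \<or> (b, c) \<in> R \<union> S"
      using step.hyps(2) step.prems biclosed_coclosed[OF R] biclosed_coclosed[OF S] by blast
    then show ?thesis using step.hyps(1) trancl_into_trancl[of a y _ b] r_into_trancl[of b c] by metis
  qed
qed

lemma biclosed_trancl_Un: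
  assumes "biclosed A R" and "biclosed A S"
  shows "biclosed A ((R \<union> S)\<^sup>+ \<inter> A)"
  using trancl_Un_coclosed[OF assms] by (intro biclosedI) (auto intro: trancl_trans)

text \<open>\<open>T\<close> is closed only under compositions that are arcs of \<open>A\<close>. As
  \<open>(a, c)\<close> is an arc, \<open>filled\<close> makes each prefix of the walk an arc as
  well, so the walk can be composed step by step.\<close>

lemma trancl_subset_biclosed:
  assumes T: "biclosed A T" and "X \<subseteq> T"
  shows "X\<^sup>+ \<inter> A \<subseteq> T"
proof -
  have "(a, c) \<in> T" if "(a, c) \<in> X\<^sup>+" "(a, c) \<in> A" for a c
    using that
  proof (induction rule: trancl_induct)
    case (step y c)
    have sub: "X \<subseteq> A" using T assms(2) biclosed_subset by blast
    have "(a, y) \<in> A\<^sup>+" using step.hyps(1) sub trancl_mono_subset by blast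
    moreover have "(y, c) \<in> A" using step.hyps(2) sub by blast
    ultimately have "(a, y) \<in> A" using filled_trancl[of a y c] step.prems by blast
    then have "(a, y) \<in> T" by (rule step.IH)
    then show ?case using biclosed_closed[OF T] step assms(2) by blast
  qed (use assms in auto)
  then show ?thesis by auto
qed

lemma is_lub_AR:
  assumes "biclosed A R" and "biclosed A S"
  shows "is_lub (AR A) ((R \<union> S)\<^sup>+ \<inter> A) {R, S}"
proof (rule least_UpperI)
  show "x \<sqsubseteq>\<^bsub>AR A\<^esub> (R \<union> S)\<^sup>+ \<inter> A" if "x \<in> {R, S}" for x
    using that assms biclosed_subset by auto
  show "(R \<union> S)\<^sup>+ \<inter> A \<sqsubseteq>\<^bsub>AR A\<^esub> y" if "y \<in> Upper (AR A) {R, S}" for y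
    using that trancl_subset_biclosed[of y "R \<union> S"] assms
    by (auto simp: Upper_def acyclic_reorientations_iff)
qed (use assms biclosed_trancl_Un in \<open>auto simp: acyclic_reorientations_iff\<close>)

text \<open>Complementation reverses inclusion, so the meet is the complement of the join of the
  complements. Note that \<open>\<inter>\<close> binds tighter than \<open>-\<close>.\<close>

lemma is_glb_AR:
  assumes "biclosed A R" and "biclosed A S"
  shows "is_glb (AR A) (A - ((A - R) \<union> (A - S))\<^sup>+ \<inter> A) {R, S}"
proof (rule greatest_LowerI)
  let ?X = "(A - R) \<union> (A - S)"
  show "A - ?X\<^sup>+ \<inter> A \<sqsubseteq>\<^bsub>AR A\<^esub> x" if "x \<in> {R, S}" for x
    using that by auto
  show "y \<sqsubseteq>\<^bsub>AR A\<^esub> A - ?X\<^sup>+ \<inter> A" if "y \<in> Lower (AR A) {R, S}" for y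
  proof -
    have y: "biclosed A y" "y \<subseteq> R" "y \<subseteq> S"
      using that assms by (auto simp: Lower_def acyclic_reorientations_iff)
    then have "?X\<^sup>+ \<inter> A \<subseteq> A - y"
      using trancl_subset_biclosed[OF biclosed_Diff, of y ?X] by blast
    then show ?thesis using y(1) biclosed_subset by fastforce
  qed
  show "A - ?X\<^sup>+ \<inter> A \<in> carrier (AR A)"
    using biclosed_Diff[OF biclosed_trancl_Un[OF biclosed_Diff[OF assms(1)] biclosed_Diff[OF assms(2)]]]
    by (simp add: acyclic_reorientations_iff)
qed (use assms in \<open>auto simp: acyclic_reorientations_iff\<close>)

lemma lattice_AR: "lattice (AR A)"
proof
  show "\<exists>s. is_lub (AR A) s {x, y}" if "x \<in> carrier (AR A)" "y \<in> carrier (AR A)" for x y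
    using that is_lub_AR by (auto simp: acyclic_reorientations_iff)
  show "\<exists>s. is_glb (AR A) s {x, y}" if "x \<in> carrier (AR A)" "y \<in> carrier (AR A)" for x y
    using that is_glb_AR by (auto simp: acyclic_reorientations_iff)
qed (auto simp: AR_def)

lemma finite_AR: "finite (carrier (AR A))"
  using finite_A by (auto simp: acyclic_reorientations_def intro: finite_subset[of _ "Pow A"])

end

section \<open>The coherent congruence\<close>

definition rope_congruence ::
    "('a \<times> 'a) set \<Rightarrow> 'a set \<Rightarrow> 'a set \<Rightarrow> (('a \<times> 'a) set \<times> ('a \<times> 'a) set) set" where
  "rope_congruence A Mho Omega =
     {(R, S). R \<in> acyclic_reorientations A \<and> S \<in> acyclic_reorientations A \<and>
        (\<forall>u v N P. (u, v, N, P) \<in> ropes A \<longrightarrow> N \<subseteq> Mho \<longrightarrow> P \<subseteq> Omega \<longrightarrow>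
           (I_join A (u, v, N, P) \<subseteq> R \<longleftrightarrow> I_join A (u, v, N, P) \<subseteq> S))}"

context skeletal_dag
begin

text \<open>By \<open>filled\<close>, an interior vertex of a path from \<open>u\<close> to
  \<open>v\<close> is joined to both ends. Ropes can then be handled without paths.\<close>

lemma transitive_support_arc:
  assumes uv: "(u, v) \<in> A"
  shows "transitive_support A u v - {u, v} = {w. (u, w) \<in> A \<and> (w, v) \<in> A}"
proof (intro equalityI subsetI)
  fix w assume w: "w \<in> transitive_support A u v - {u, v}"
  then obtain p where p: "dipath A p" "hd p = u" "last p = v" "w \<in> set p"
    by (auto simp: transitive_support_def)
  then obtain i where i: "i < length p" "p ! i = w" by (auto simp: in_set_conv_nth)
  have suc: "successively (\<lambda>x y. (x, y) \<in> A) p" and ends: "p ! 0 = u" "p ! (length p - 1) = v"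
    using p by (auto simp: dipath_def hd_conv_nth last_conv_nth)
  have "i \<noteq> 0" "i \<noteq> length p - 1" using w i(2) ends by (metis Diff_iff insertCI)+
  then have "(u, w) \<in> A\<^sup>+" "(w, v) \<in> A\<^sup>+"
    using successively_imp_trancl[OF suc, of 0 i] successively_imp_trancl[OF suc, of i "length p - 1"]
      i ends by auto
  then show "w \<in> {w. (u, w) \<in> A \<and> (w, v) \<in> A}" using filled_trancl uv by simp
next
  fix w assume w: "w \<in> {w. (u, w) \<in> A \<and> (w, v) \<in> A}"
  then have "dipath A [u, w, v]" using acyclic_imp_dipath[OF acyclic_A] by simp
  then have "w \<in> transitive_support A u v"
    unfolding transitive_support_def by (intro CollectI exI[of _ "[u, w, v]"]) simp
  then show "w \<in> transitive_support A u v - {u, v}" using w A_irrefl by auto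
qed

section \<open>Ropes and the biclosed sets they define\<close>

lemma ropes_iff:
  "(u, v, N, P) \<in> ropes A \<longleftrightarrow>
     (u, v) \<in> A \<and> N \<inter> P = {} \<and> N \<union> P = {w. (u, w) \<in> A \<and> (w, v) \<in> A}"
  by (cases "(u, v) \<in> A") (simp_all add: ropes_def transitive_support_arc)

lemma mem_I_join:
  "(w, w') \<in> I_join A (u, v, N, P) \<longleftrightarrow> (w, w') \<in> A \<and> w \<in> P \<union> {u} \<and> w' \<in> N \<union> {v}"
  by (auto simp: I_join_def)

text \<open>\<open>c\<close> is reachable from \<open>u\<close> through \<open>a\<close> and reaches
  \<open>v\<close> through \<open>b\<close>, so \<open>filled\<close> joins it to both
  \<open>u\<close> and \<open>v\<close>.\<close>

lemma rope_arc_between: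
  assumes rope: "(u, v, N, P) \<in> ropes A"
    and a: "a \<in> N \<union> P \<union> {u}" and b: "b \<in> N \<union> P \<union> {v}"
    and c: "(a, c) \<in> A" "(c, b) \<in> A"
  shows "c \<in> N \<union> P"
proof -
  have uv: "(u, v) \<in> A" and NP: "N \<union> P = {w. (u, w) \<in> A \<and> (w, v) \<in> A}"
    using rope by (auto simp: ropes_iff)
  have "a = u \<or> (u, a) \<in> A" "b = v \<or> (b, v) \<in> A" using a b NP by auto
  then have "(u, c) \<in> A\<^sup>+" "(c, v) \<in> A\<^sup>+" using c by (meson r_into_trancl trancl_trans)+
  then show ?thesis using filled_trancl uv NP by blast
qed

lemma mem_nabla:
  "R \<subseteq> A \<Longrightarrow> w \<in> nabla A (reorient A R) u v \<longleftrightarrow> (u, w) \<in> R \<and> (w, v) \<in> A \<and> (w, v) \<notin> R"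
  using reorient_arc(1) by (auto simp: nabla_def)

lemma mem_Delta:
  "R \<subseteq> A \<Longrightarrow> w \<in> Delta A (reorient A R) u v \<longleftrightarrow> (u, w) \<in> A \<and> (u, w) \<notin> R \<and> (w, v) \<in> R"
  using reorient_arc(1) by (auto simp: Delta_def)

text \<open>For each vertex between \<open>a\<close> and \<open>b\<close>, coclosedness puts at
  least one of its two arcs in \<open>R\<close> and \<open>irr\<close> at most one, whence the
  partition. For \<open>w\<close> in \<open>P \<union> {a}\<close> and \<open>w'\<close> in
  \<open>N \<union> {b}\<close>, splitting \<open>(w, b) \<in> R\<close> at \<open>w'\<close> gives
  \<open>(w, w') \<in> R\<close>.\<close>

lemma nabla_Delta_rope:
  assumes R: "biclosed A R" and ab: "(a, b) \<in> R"
    and irr: "\<And>c. (a, c) \<in> R \<Longrightarrow> (c, b) \<in> R \<Longrightarrow> False"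
  defines "N \<equiv> nabla A (reorient A R) a b" and "P \<equiv> Delta A (reorient A R) a b"
  shows "(a, b, N, P) \<in> ropes A" and "I_join A (a, b, N, P) \<subseteq> R"
proof -
  have sub: "R \<subseteq> A" using R by (rule biclosed_subset)
  have N: "w \<in> N \<longleftrightarrow> (a, w) \<in> R \<and> (w, b) \<in> A \<and> (w, b) \<notin> R" for w
    unfolding N_def using mem_nabla[OF sub] .
  have P: "w \<in> P \<longleftrightarrow> (a, w) \<in> A \<and> (a, w) \<notin> R \<and> (w, b) \<in> R" for w
    unfolding P_def using mem_Delta[OF sub] .
  show "(a, b, N, P) \<in> ropes A"
    unfolding ropes_iff set_eq_iff Un_iff Int_iff mem_Collect_eq empty_iff N P
    using ab sub irr biclosed_coclosed[OF R ab] by blast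
  have "(w, w') \<in> R" if "(w, w') \<in> A" "w \<in> P \<union> {a}" "w' \<in> N \<union> {b}" for w w'
    using that ab biclosed_coclosed[OF R, of w b w'] by (auto simp: N P)
  then show "I_join A (a, b, N, P) \<subseteq> R" by (auto simp: mem_I_join)
qed

text \<open>An arc \<open>(a, b)\<close> of minimal length among those of \<open>S\<close> from \<open>N \<union> {u}\<close> to \<open>P \<union> {v}\<close> works.\<close>

lemma crossing_subrope:
  assumes S: "biclosed A S" and rope: "(u, v, N, P) \<in> ropes A"
    and "(a, b) \<in> S" and "a \<in> N \<union> {u}" and "b \<in> P \<union> {v}"
  shows "\<exists>a b N' P'. (a, b, N', P') \<in> ropes A \<and> N' \<subseteq> N \<and> P' \<subseteq> P \<and>
    I_join A (a, b, N', P') \<subseteq> S \<and> (a, b) \<in> A \<and> a \<in> N \<union> {u} \<and> b \<in> P \<union> {v}"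
proof -
  obtain f :: "'a \<Rightarrow> nat" where f: "\<And>a b. (a, b) \<in> A \<Longrightarrow> f a < f b"
    using finite_acyclic_rank[OF finite_A acyclic_A] by blast
  have sub: "S \<subseteq> A" using S by (rule biclosed_subset)
  show ?thesis using assms(3-5)
  proof (induction "f b - f a" arbitrary: a b rule: less_induct)
    case less
    have between: "c \<in> N \<union> P" if "(a, c) \<in> A" "(c, b) \<in> A" for c
      by (rule rope_arc_between[OF rope _ _ that]) (use less.prems in auto)
    have shorter: "f c - f a < f b - f a" "f b - f c < f b - f a"
      if "(a, c) \<in> A" "(c, b) \<in> A" for c
      using f[OF that(1)] f[OF that(2)] by simp_all
    show ?case
    proof (cases "\<exists>c. (a, c) \<in> A \<and> (c, b) \<in> A \<and> (c \<in> N \<and> (c, b) \<in> S \<or> c \<in> P \<and> (a, c) \<in> S)")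
      \<comment> \<open>\<open>(c, b)\<close> or \<open>(a, c)\<close> is again an arc of
        \<open>S\<close> from \<open>N \<union> {u}\<close> to \<open>P \<union> {v}\<close>, and a
        shorter one.\<close>
      case True
      then obtain c where c: "(a, c) \<in> A" "(c, b) \<in> A"
        and "c \<in> N \<and> (c, b) \<in> S \<or> c \<in> P \<and> (a, c) \<in> S" by blast
      then show ?thesis
        using less.hyps[of b c] less.hyps[of c a] shorter[OF c] less.prems by auto
    next
      case False
      let ?N = "nabla A (reorient A S) a b" and ?P = "Delta A (reorient A S) a b"
      \<comment> \<open>Without such \<open>c\<close>, a vertex whose arc from \<open>a\<close> is
        in \<open>S\<close> cannot be in \<open>P\<close>, and one whose arc to \<open>b\<close> is
        in \<open>S\<close> cannot be in \<open>N\<close>.\<close>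
      have irr: False if "(a, c) \<in> S" "(c, b) \<in> S" for c
        using False between[of c] that sub by blast
      have "?N \<subseteq> N" unfolding subset_iff mem_nabla[OF sub] using False between sub by blast
      moreover have "?P \<subseteq> P" unfolding subset_iff mem_Delta[OF sub] using False between sub by blast
      moreover have "(a, b, ?N, ?P) \<in> ropes A" "I_join A (a, b, ?N, ?P) \<subseteq> S"
        using nabla_Delta_rope[OF S less.prems(1)] irr by blast+
      ultimately show ?thesis using less.prems sub by blast
    qed
  qed
qed

text \<open>An \<open>I_join\<close> lies below \<open>A - R\<close> iff it is disjoint from
  \<open>R\<close>. So the sets below \<open>R\<close> for one pair must determine the sets disjoint
  from \<open>R\<close> for the exchanged pair.\<close>

lemma rope_congruence_Diff:
  assumes RS: "(R, S) \<in> rope_congruence A Mho Omega"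
  shows "(A - R, A - S) \<in> rope_congruence A Omega Mho"
proof -
  have R: "biclosed A R" and S: "biclosed A S"
    using RS by (auto simp: rope_congruence_def acyclic_reorientations_iff)
  have eq: "I_join A (u, v, N, P) \<subseteq> R \<longleftrightarrow> I_join A (u, v, N, P) \<subseteq> S"
    if "(u, v, N, P) \<in> ropes A" "N \<subseteq> Mho" "P \<subseteq> Omega" for u v N P
    using RS that unfolding rope_congruence_def by blast
  \<comment> \<open>A common arc with \<open>Y\<close> crosses the rope with \<open>N\<close> and
    \<open>P\<close> exchanged. \<open>crossing_subrope\<close> turns it into an admissible
    \<open>I_join\<close> below \<open>Y\<close>, hence below \<open>X\<close>, whose arc
    \<open>(a, b)\<close> also lies in the original \<open>I_join\<close>.\<close>
  have disjoint: "I_join A (u, v, N, P) \<inter> Y = {}"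
    if rope: "(u, v, N, P) \<in> ropes A" "N \<subseteq> Omega" "P \<subseteq> Mho"
      and X: "I_join A (u, v, N, P) \<inter> X = {}" and Y: "biclosed A Y"
      and eq: "\<And>u v N P. (u, v, N, P) \<in> ropes A \<Longrightarrow> N \<subseteq> Mho \<Longrightarrow> P \<subseteq> Omega \<Longrightarrow>
        I_join A (u, v, N, P) \<subseteq> Y \<Longrightarrow> I_join A (u, v, N, P) \<subseteq> X"
    for u v N P X Y
  proof (rule ccontr)
    assume "\<not> ?thesis"
    then obtain a b where ab: "(a, b) \<in> Y" "(a, b) \<in> I_join A (u, v, N, P)" by fast
    then have ab': "a \<in> P \<union> {u}" "b \<in> N \<union> {v}" by (simp_all add: mem_I_join)
    have rope': "(u, v, P, N) \<in> ropes A" using rope(1) by (auto simp: ropes_iff)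
    obtain a b N' P' where *: "(a, b, N', P') \<in> ropes A" "N' \<subseteq> P" "P' \<subseteq> N"
      "I_join A (a, b, N', P') \<subseteq> Y" "(a, b) \<in> A" "a \<in> P \<union> {u}" "b \<in> N \<union> {v}"
      using crossing_subrope[OF Y rope' ab(1) ab'] by blast
    then have "I_join A (a, b, N', P') \<subseteq> X" using eq rope(2,3) by blast
    moreover have "(a, b) \<in> I_join A (a, b, N', P')" using *(5) by (simp add: mem_I_join)
    moreover have "(a, b) \<in> I_join A (u, v, N, P)" using *(5-7) by (simp add: mem_I_join)
    ultimately show False using X by blast
  qed
  have iff: "I \<subseteq> A - T \<longleftrightarrow> I \<inter> T = {}" if "I \<subseteq> A" for I T :: "('a \<times> 'a) set"
    using that by blast
  have sub: "I_join A (u, v, N, P) \<subseteq> A" for u v N P by (auto simp: mem_I_join)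
  show ?thesis
    unfolding rope_congruence_def mem_Collect_eq case_prod_conv iff[OF sub]
      acyclic_reorientations_iff
  proof (intro conjI allI impI iffI)
    show "biclosed A (A - R)" "biclosed A (A - S)" using R S by (simp_all add: biclosed_Diff)
  next
    fix u v N P assume "(u, v, N, P) \<in> ropes A" "N \<subseteq> Omega" "P \<subseteq> Mho" "I_join A (u, v, N, P) \<inter> R = {}"
    then show "I_join A (u, v, N, P) \<inter> S = {}" using disjoint[where X = R and Y = S] S eq by blast
  next
    fix u v N P assume "(u, v, N, P) \<in> ropes A" "N \<subseteq> Omega" "P \<subseteq> Mho" "I_join A (u, v, N, P) \<inter> S = {}"
    then show "I_join A (u, v, N, P) \<inter> R = {}" using disjoint[where X = S and Y = R] R eq by blast
  qed
qed

lemma rope_congruence_Diff_iff: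
  assumes "R \<subseteq> A" and "S \<subseteq> A"
  shows "(A - R, A - S) \<in> rope_congruence A Omega Mho \<longleftrightarrow> (R, S) \<in> rope_congruence A Mho Omega"
  using rope_congruence_Diff[of R S Mho Omega] rope_congruence_Diff[of "A - R" "A - S" Omega Mho]
    double_diff[OF assms(1) subset_refl] double_diff[OF assms(2) subset_refl] by auto

text \<open>Arcs never compose, because sources lie in \<open>P \<union> {u}\<close> and targets in
  the disjoint set \<open>N \<union> {v}\<close>. A vertex between the ends of an arc is in
  \<open>N\<close> or \<open>P\<close>, which puts the first or the second part in the set; neither
  part is \<open>(u, v)\<close>.\<close>

lemma
  assumes rope: "(u, v, N, P) \<in> ropes A"
  shows biclosed_I_join: "biclosed A (I_join A (u, v, N, P))"
    and biclosed_I_join_remove: "biclosed A (I_join A (u, v, N, P) - {(u, v)})"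
proof -
  have NP: "N \<union> P = {w. (u, w) \<in> A \<and> (w, v) \<in> A}" "N \<inter> P = {}" and uv: "(u, v) \<in> A"
    using rope by (auto simp: ropes_iff)
  have "u \<notin> N" "v \<notin> P" "u \<noteq> v" using NP uv A_irrefl by auto
  then have no_comp: False
    if "(a, b) \<in> I_join A (u, v, N, P)" "(b, c) \<in> I_join A (u, v, N, P)" for a b c
    using that NP by (auto simp: mem_I_join)
  have split: "(a, b) \<in> I_join A (u, v, N, P) - {(u, v)} \<or> (b, c) \<in> I_join A (u, v, N, P) - {(u, v)}"
    if ac: "(a, c) \<in> I_join A (u, v, N, P)" and b: "(a, b) \<in> A" "(b, c) \<in> A" for a b c
  proof -
    have "b \<in> N \<union> P"
      by (rule rope_arc_between[OF rope _ _ b]) (use ac in \<open>auto simp: mem_I_join\<close>)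
    moreover from this have "b \<noteq> u" "b \<noteq> v" using NP A_irrefl by auto
    ultimately show ?thesis using ac b by (auto simp: mem_I_join)
  qed
  show "biclosed A (I_join A (u, v, N, P))"
  proof (rule biclosedI)
    show "I_join A (u, v, N, P) \<subseteq> A" by (auto simp: mem_I_join)
  qed (use no_comp split in blast)+
  show "biclosed A (I_join A (u, v, N, P) - {(u, v)})"
  proof (rule biclosedI)
    show "I_join A (u, v, N, P) - {(u, v)} \<subseteq> A" by (auto simp: mem_I_join)
  qed (use no_comp split in blast)+
qed

text \<open>A biclosed subset containing \<open>(u, v)\<close> is everything: coclosedness splits
  \<open>(u, v)\<close> at a vertex of \<open>P\<close>, then \<open>(w, v)\<close> at a vertex of
  \<open>N\<close>, and each time only one part belongs to the \<open>I_join\<close>.\<close>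

lemma biclosed_subset_I_join:
  assumes rope: "(u, v, N, P) \<in> ropes A" and S: "biclosed A S"
    and sub: "S \<subset> I_join A (u, v, N, P)"
  shows "S \<subseteq> I_join A (u, v, N, P) - {(u, v)}"
proof -
  have NP: "N \<union> P = {w. (u, w) \<in> A \<and> (w, v) \<in> A}" "N \<inter> P = {}"
    using rope by (auto simp: ropes_iff)
  have N: "(w, v) \<notin> S" if w: "w \<in> N" for w
  proof
    assume "(w, v) \<in> S"
    then have "w \<in> P \<union> {u}" using sub mem_I_join by blast
    then show False using w NP A_irrefl by blast
  qed
  have "I_join A (u, v, N, P) \<subseteq> S" if uv: "(u, v) \<in> S"
  proof (rule subrelI)
    fix w w' assume "(w, w') \<in> I_join A (u, v, N, P)"
    then have w: "(w, w') \<in> A" "w \<in> P \<union> {u}" "w' \<in> N \<union> {v}" by (auto simp: mem_I_join)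
    have "(u, p) \<notin> S" if p: "p \<in> P" for p
    proof
      assume "(u, p) \<in> S"
      then have "p \<in> N \<union> {v}" using sub mem_I_join by blast
      then show False using p NP A_irrefl by blast
    qed
    then have "(w, v) \<in> S"
      using w(2) uv biclosed_coclosed[OF S uv, of w] NP by blast
    then show "(w, w') \<in> S"
      using w biclosed_coclosed[OF S _ w(1), of v] N NP by blast
  qed
  then show ?thesis using sub by blast
qed

lemma covers_AR_iff:
  "covers (AR A) y x \<longleftrightarrow> biclosed A x \<and> biclosed A y \<and> x \<subset> y \<and>
     \<not> (\<exists>z. biclosed A z \<and> x \<subset> z \<and> z \<subset> y)"
  by (auto simp: covers_def acyclic_reorientations_iff)

lemma covers_I_join:
  assumes rope: "(u, v, N, P) \<in> ropes A"
  shows "covers (AR A) (I_join A (u, v, N, P)) x \<longleftrightarrow> x = I_join A (u, v, N, P) - {(u, v)}"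
proof -
  let ?I = "I_join A (u, v, N, P)"
  have "(u, v) \<in> ?I" using rope by (auto simp: ropes_iff mem_I_join)
  then have lt: "?I - {(u, v)} \<subset> ?I" by blast
  show ?thesis
    using biclosed_I_join[OF rope] biclosed_I_join_remove[OF rope] biclosed_subset_I_join[OF rope] lt
    unfolding covers_AR_iff by blast
qed

section \<open>Identification of the coherent congruence\<close>

lemma lattice_congruence_rope_congruence:
  "lattice_congruence (AR A) (rope_congruence A Mho Omega)"
proof -
  interpret lattice "AR A" by (rule lattice_AR)
  let ?C = "carrier (AR A)"
  have sub: "x \<subseteq> A" if "x \<in> ?C" for x
    using that by (simp add: acyclic_reorientations_def)
  have I: "I_join A (u, v, N, P) \<in> ?C" "A - I_join A (u, v, N, P) \<in> ?C"
    if "(u, v, N, P) \<in> ropes A" for u v N P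
    using biclosed_I_join[OF that] by (simp_all add: acyclic_reorientations_iff biclosed_Diff)
  have meet_iff: "z \<subseteq> x \<sqinter>\<^bsub>AR A\<^esub> y \<longleftrightarrow> z \<subseteq> x \<and> z \<subseteq> y" if "x \<in> ?C" "y \<in> ?C" "z \<in> ?C" for x y z
    using meet_le[of z x y] meet_left[of x y] meet_right[of x y] that by auto
  have join_iff: "x \<squnion>\<^bsub>AR A\<^esub> y \<subseteq> z \<longleftrightarrow> x \<subseteq> z \<and> y \<subseteq> z" if "x \<in> ?C" "y \<in> ?C" "z \<in> ?C" for x y z
    using join_le[of x z y] join_left[of x y] join_right[of x y] that by auto
  have Diff_swap: "I \<subseteq> A - x \<longleftrightarrow> x \<subseteq> A - I" if "x \<subseteq> A" "I \<subseteq> A" for I x :: "('a \<times> 'a) set"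
    using that by blast
  have memD: "x \<in> ?C" "y \<in> ?C" if "(x, y) \<in> rope_congruence A M Om" for x y M Om
    using that by (auto simp: rope_congruence_def)
  have below: "I_join A (u, v, N, P) \<subseteq> x \<longleftrightarrow> I_join A (u, v, N, P) \<subseteq> y"
    if "(x, y) \<in> rope_congruence A M Om" "(u, v, N, P) \<in> ropes A" "N \<subseteq> M" "P \<subseteq> Om"
    for x y M Om u v N P
    using that unfolding rope_congruence_def by blast
  have meet: "(x \<sqinter>\<^bsub>AR A\<^esub> y, x' \<sqinter>\<^bsub>AR A\<^esub> y') \<in> rope_congruence A Mho Omega"
    if xy: "(x, x') \<in> rope_congruence A Mho Omega" "(y, y') \<in> rope_congruence A Mho Omega" for x x' y y'
  proof -
    note C = memD[OF xy(1)] memD[OF xy(2)]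
    have "I_join A (u, v, N, P) \<subseteq> x \<sqinter>\<^bsub>AR A\<^esub> y \<longleftrightarrow> I_join A (u, v, N, P) \<subseteq> x' \<sqinter>\<^bsub>AR A\<^esub> y'"
      if rope: "(u, v, N, P) \<in> ropes A" "N \<subseteq> Mho" "P \<subseteq> Omega" for u v N P
      using below[OF xy(1) rope] below[OF xy(2) rope] meet_iff[OF C(1,3) I(1)[OF rope(1)]]
        meet_iff[OF C(2,4) I(1)[OF rope(1)]] by simp
    moreover have "x \<sqinter>\<^bsub>AR A\<^esub> y \<in> ?C" "x' \<sqinter>\<^bsub>AR A\<^esub> y' \<in> ?C"
      using meet_closed[OF C(1,3)] meet_closed[OF C(2,4)] .
    ultimately show ?thesis unfolding rope_congruence_def by simp
  qed
  have join: "(x \<squnion>\<^bsub>AR A\<^esub> y, x' \<squnion>\<^bsub>AR A\<^esub> y') \<in> rope_congruence A Mho Omega"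
    if xy: "(x, x') \<in> rope_congruence A Mho Omega" "(y, y') \<in> rope_congruence A Mho Omega" for x x' y y'
  proof -
    note C = memD[OF xy(1)] memD[OF xy(2)]
    have J: "x \<squnion>\<^bsub>AR A\<^esub> y \<in> ?C" "x' \<squnion>\<^bsub>AR A\<^esub> y' \<in> ?C" 
      using join_closed[OF C(1,3)] join_closed[OF C(2,4)] .
    have D: "(A - x, A - x') \<in> rope_congruence A Omega Mho" "(A - y, A - y') \<in> rope_congruence A Omega Mho"
      using xy by (simp_all add: rope_congruence_Diff)
    have "I_join A (u, v, N, P) \<subseteq> A - (x \<squnion>\<^bsub>AR A\<^esub> y) \<longleftrightarrow> I_join A (u, v, N, P) \<subseteq> A - (x' \<squnion>\<^bsub>AR A\<^esub> y')"
      if rope: "(u, v, N, P) \<in> ropes A" "N \<subseteq> Omega" "P \<subseteq> Mho" for u v N P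
    proof -
      let ?I = "I_join A (u, v, N, P)"
      \<comment> \<open>Disjointness from \<open>?I\<close> means lying below \<open>A - ?I\<close>,
        which is itself in the lattice, so it can be tested on the two joinands.\<close>
      have split: "?I \<subseteq> A - (s \<squnion>\<^bsub>AR A\<^esub> t) \<longleftrightarrow> ?I \<subseteq> A - s \<and> ?I \<subseteq> A - t"
        if "s \<in> ?C" "t \<in> ?C" for s t
        using join_iff[OF that I(2)[OF rope(1)]] sub[OF that(1)] sub[OF that(2)]
          sub[OF join_closed[OF that]] sub[OF I(1)[OF rope(1)]] by (simp add: Diff_swap)
      show ?thesis
        using split[of x y] split[of x' y'] C below[OF D(1) rope] below[OF D(2) rope] by simp
    qed
    moreover have "A - (x \<squnion>\<^bsub>AR A\<^esub> y) \<in> ?C" "A - (x' \<squnion>\<^bsub>AR A\<^esub> y') \<in> ?C"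
      using J biclosed_Diff by (auto simp: acyclic_reorientations_iff)
    ultimately have "(A - (x \<squnion>\<^bsub>AR A\<^esub> y), A - (x' \<squnion>\<^bsub>AR A\<^esub> y')) \<in> rope_congruence A Omega Mho"
      unfolding rope_congruence_def by simp
    then show ?thesis using rope_congruence_Diff_iff sub J by simp
  qed
  have "equiv ?C (rope_congruence A Mho Omega)"
    unfolding rope_congruence_def by (auto simp: equiv_def refl_on_def sym_def trans_def)
  then show ?thesis unfolding lattice_congruence_def using meet join by simp
qed

text \<open>If \<open>J\<close> is separated from its lower cover, some admissible
  \<open>I_join\<close> is below \<open>J\<close> but not below the cover, so it equals
  \<open>J\<close>. Conversely, an admissible \<open>I_join\<close> separates itself from its own
  lower cover.\<close>

lemma uncontracted_rope_congruence:
  "{J. join_irreducible (AR A) J \<and> \<not> contracts (AR A) (rope_congruence A Mho Omega) J} =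
   {I_join A (u, v, N, P) | u v N P. (u, v, N, P) \<in> ropes A \<and> N \<subseteq> Mho \<and> P \<subseteq> Omega}"
  (is "?L = ?R")
proof (intro equalityI subsetI)
  interpret lattice "AR A" by (rule lattice_AR)
  fix J assume "J \<in> ?L"
  then have ji: "join_irreducible (AR A) J"
    and un: "\<not> contracts (AR A) (rope_congruence A Mho Omega) J" by auto
  define K where "K = (THE x. covers (AR A) J x)"
  have "\<exists>!x. covers (AR A) J x" using ji by (simp add: join_irreducible_def)
  then have "covers (AR A) J K" unfolding K_def by (rule theI')
  then have K: "biclosed A J" "biclosed A K" "K \<subset> J" by (auto simp: covers_AR_iff)
  have "(K, J) \<notin> rope_congruence A Mho Omega" using un by (simp add: contracts_def K_def)
  then obtain u v N P where rope: "(u, v, N, P) \<in> ropes A" "N \<subseteq> Mho" "P \<subseteq> Omega"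
    and "\<not> (I_join A (u, v, N, P) \<subseteq> K \<longleftrightarrow> I_join A (u, v, N, P) \<subseteq> J)"
    using K unfolding rope_congruence_def acyclic_reorientations_iff by blast
  then have I: "I_join A (u, v, N, P) \<subseteq> J" "\<not> I_join A (u, v, N, P) \<subseteq> K" using K by auto
  have "I_join A (u, v, N, P) = J"
  proof (rule ccontr)
    assume "\<not> ?thesis"
    then have "I_join A (u, v, N, P) \<subset> J" using I by blast
    then have "I_join A (u, v, N, P) \<subseteq> K"
      using le_lower_cover[OF finite_AR ji, of "I_join A (u, v, N, P)"] biclosed_I_join[OF rope(1)]
      by (simp add: K_def acyclic_reorientations_iff)
    then show False using I by simp
  qed
  then show "J \<in> ?R" using rope by blast
next
  fix J assume "J \<in> ?R"
  then obtain u v N P where J: "J = I_join A (u, v, N, P)"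
    and rope: "(u, v, N, P) \<in> ropes A" "N \<subseteq> Mho" "P \<subseteq> Omega" by blast
  \<comment> \<open>As an equation between predicates, this evaluates both the unique existence and
    the \<open>THE\<close> by rewriting.\<close>
  have cov: "covers (AR A) J = (\<lambda>x. x = J - {(u, v)})"
    using covers_I_join[OF rope(1)] J by blast
  have "(u, v) \<in> J" using rope(1) by (auto simp: J ropes_iff mem_I_join)
  then have "\<not> J \<subseteq> J - {(u, v)}" by blast
  then have "(J - {(u, v)}, J) \<notin> rope_congruence A Mho Omega"
    using rope J unfolding rope_congruence_def by blast
  then show "J \<in> ?L" by (simp add: join_irreducible_def contracts_def cov)
qed

lemma coherent_congruence_eq: "coherent_congruence A Mho Omega = rope_congruence A Mho Omega"
  unfolding coherent_congruence_def
proof (rule the_equality)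
  show "lattice_congruence (AR A) (rope_congruence A Mho Omega) \<and>
    {J. join_irreducible (AR A) J \<and> \<not> contracts (AR A) (rope_congruence A Mho Omega) J} =
    {I_join A (u, v, N, P) | u v N P. (u, v, N, P) \<in> ropes A \<and> N \<subseteq> Mho \<and> P \<subseteq> Omega}"
    using lattice_congruence_rope_congruence uncontracted_rope_congruence by blast
next
  fix \<theta> assume "lattice_congruence (AR A) \<theta> \<and>
    {J. join_irreducible (AR A) J \<and> \<not> contracts (AR A) \<theta> J} =
    {I_join A (u, v, N, P) | u v N P. (u, v, N, P) \<in> ropes A \<and> N \<subseteq> Mho \<and> P \<subseteq> Omega}"
  then show "\<theta> = rope_congruence A Mho Omega"
    by (intro lattice.lattice_congruence_eqI[OF lattice_AR finite_AR]
        lattice_congruence_rope_congruence)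
      (simp_all only: uncontracted_rope_congruence)
qed

end

section \<open>Minimal and maximal elements of the classes\<close>

context skeletal_dag
begin

lemma biclosed_imp_acyclic: "biclosed A R \<Longrightarrow> acyclic (reorient A R)"
  using acyclic_reorientations_iff by (auto simp: acyclic_reorientations_def)

text \<open>Here \<open>c\<close> subdivides \<open>(v, u)\<close> in the reorientation. Whatever
  its place relative to \<open>u\<close> and \<open>v\<close> in \<open>A\<close>, the sets of
  \<open>(u, v)\<close> are covered by those of the reversed arcs among the two parts.\<close>

lemma nabla_Delta_split:
  assumes R: "biclosed A R" and uv: "(u, v) \<in> R"
    and c: "(v, c) \<in> reorient A R" "(c, u) \<in> reorient A R"
  shows "w \<in> nabla A (reorient A R) u v \<Longrightarrow>
      (u, c) \<in> R \<and> w \<in> nabla A (reorient A R) u c \<or> (c, v) \<in> R \<and> w \<in> nabla A (reorient A R) c v"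
    and "w \<in> Delta A (reorient A R) u v \<Longrightarrow>
      (u, c) \<in> R \<and> w \<in> Delta A (reorient A R) u c \<or> (c, v) \<in> R \<and> w \<in> Delta A (reorient A R) c v"
proof -
  have sub: "R \<subseteq> A" using R by (rule biclosed_subset)
  note mem = mem_nabla[OF sub] mem_Delta[OF sub]
  note cl = biclosed_closed[OF R] and co = biclosed_coclosed[OF R]
  have uvA: "(u, v) \<in> A" using uv sub by blast
  \<comment> \<open>In \<open>A\<close>, the vertex \<open>c\<close> lies between \<open>u\<close>
    and \<open>v\<close>, before \<open>u\<close>, or after \<open>v\<close>; arcs
    \<open>(v, c)\<close> and \<open>(c, u)\<close> of \<open>A\<close> would close a triangle with
    \<open>(u, v)\<close>.\<close>
  consider (middle) "(u, c) \<in> R" "(c, v) \<in> R" | (below) "(c, u) \<in> A" "(c, u) \<notin> R" "(c, v) \<in> R"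
    | (above) "(u, c) \<in> R" "(v, c) \<in> A" "(v, c) \<notin> R"
    using c sub uvA A_no_triangle[of u v c] unfolding reorient_def by blast
  note cases = this
  show "(u, c) \<in> R \<and> w \<in> nabla A (reorient A R) u c \<or> (c, v) \<in> R \<and> w \<in> nabla A (reorient A R) c v"
    if "w \<in> nabla A (reorient A R) u v"
  proof -
    have w: "(u, w) \<in> R" "(w, v) \<in> A" "(w, v) \<notin> R" using that by (simp_all add: mem)
    then have uw: "(u, w) \<in> A" using sub by blast
    from cases show ?thesis
    proof cases
      case middle
      then have "(u, c) \<in> A" "(c, v) \<in> A" using sub by auto
      then have "w = c \<or> (w, c) \<in> A \<or> (c, w) \<in> A" using between_comparable uw w(2) by blast
      then show ?thesis
        unfolding mem using middle w cl[of w c v] co[of c v w] by blast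
    next
      case below
      then have "(c, w) \<in> A" using filled4[of c u w v] uw w sub by blast
      then show ?thesis unfolding mem using below w co[of c v w] by blast
    next
      case above
      then have "(w, c) \<in> A" using filled4[of u w v c] uw w sub by blast
      then show ?thesis unfolding mem using above w co[of w c v] by blast
    qed
  qed
  show "(u, c) \<in> R \<and> w \<in> Delta A (reorient A R) u c \<or> (c, v) \<in> R \<and> w \<in> Delta A (reorient A R) c v"
    if "w \<in> Delta A (reorient A R) u v"
  proof -
    have w: "(u, w) \<in> A" "(u, w) \<notin> R" "(w, v) \<in> R" using that by (simp_all add: mem)
    then have wv: "(w, v) \<in> A" using sub by blast
    from cases show ?thesis
    proof cases
      case middle
      then have "(u, c) \<in> A" "(c, v) \<in> A" using sub by auto
      then have "w = c \<or> (w, c) \<in> A \<or> (c, w) \<in> A" using between_comparable wv w(1) by blast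
      then show ?thesis
        unfolding mem using middle w cl[of u c w] co[of u c w] by blast
    next
      case below
      then have "(c, w) \<in> A" using filled4[of c u w v] wv w sub by blast
      then show ?thesis unfolding mem using below w co[of c w u] by blast
    next
      case above
      then have "(w, c) \<in> A" using filled4[of u w v c] wv w sub by blast
      then show ?thesis unfolding mem using above w co[of u c w] by blast
    qed
  qed
qed

text \<open>A triangle on which removing \<open>(u, v)\<close> breaks biclosedness would provide a
  two-step path from \<open>v\<close> to \<open>u\<close> in the reorientation.\<close>

lemma biclosed_remove_arc:
  assumes R: "biclosed A R" and uv: "(u, v) \<in> R"
    and red: "\<And>c. (v, c) \<in> reorient A R \<Longrightarrow> (c, u) \<in> reorient A R \<Longrightarrow> False"
  shows "biclosed A (R - {(u, v)})"
proof -
  have sub: "R \<subseteq> A" using R by (rule biclosed_subset)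
  have E: "(x, y) \<in> reorient A R" if "(y, x) \<in> R \<or> (x, y) \<in> A \<and> (x, y) \<notin> R" for x y
    using that by (auto simp: reorient_def)
  show ?thesis
  proof (rule biclosedI)
    fix a b c assume "(a, b) \<in> R - {(u, v)}" "(b, c) \<in> R - {(u, v)}" "(a, c) \<in> A"
    then show "(a, c) \<in> R - {(u, v)}" using biclosed_closed[OF R] red E by blast
  next
    fix a b c
    assume "(a, c) \<in> R - {(u, v)}" "(a, b) \<in> A" "(b, c) \<in> A" "(a, b) \<notin> R - {(u, v)}"
    then show "(b, c) \<in> R - {(u, v)}" using biclosed_coclosed[OF R, of a c b] red E by blast
  qed (use sub in blast)
qed

lemma minimal_in_class_iff:
  "minimal_in_class (AR A) (rope_congruence A Mho Omega) R \<longleftrightarrow>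
     biclosed A R \<and> \<not> (\<exists>S. (R, S) \<in> rope_congruence A Mho Omega \<and> S \<subset> R)"
  by (auto simp: minimal_in_class_def acyclic_reorientations_iff)

lemma maximal_in_class_iff:
  "maximal_in_class (AR A) (rope_congruence A Mho Omega) R \<longleftrightarrow>
     biclosed A R \<and> \<not> (\<exists>S. (R, S) \<in> rope_congruence A Mho Omega \<and> R \<subset> S)"
  by (auto simp: maximal_in_class_def acyclic_reorientations_iff)

text \<open>Removing \<open>(u, v)\<close> leaves an acyclic reorientation, which by minimality is
  in another class. So an admissible \<open>I_join\<close> below \<open>R\<close> contains
  \<open>(u, v)\<close>, and its rope bounds the two sets.\<close>

lemma minimal_imp_reduced_arcs:
  assumes min: "minimal_in_class (AR A) (rope_congruence A Mho Omega) R"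
    and uv: "(u, v) \<in> A" "(v, u) \<in> transitive_reduction (reorient A R)"
  shows "nabla A (reorient A R) u v \<subseteq> Mho \<and> Delta A (reorient A R) u v \<subseteq> Omega"
proof -
  have R: "biclosed A R" using min by (simp add: minimal_in_class_iff)
  then have sub: "R \<subseteq> A" by (rule biclosed_subset)
  have red: "(v, u) \<in> reorient A R" "\<And>c. (v, c) \<in> reorient A R \<Longrightarrow> (c, u) \<in> reorient A R \<Longrightarrow> False"
    using uv(2) transitive_reduction_reorient[OF sub biclosed_imp_acyclic[OF R]] by blast+
  then have uvR: "(u, v) \<in> R" using reorient_arc(2)[OF sub uv(1)] by simp
  have "biclosed A (R - {(u, v)})" using biclosed_remove_arc[OF R uvR] red(2) by blast
  moreover have "(R, R - {(u, v)}) \<notin> rope_congruence A Mho Omega"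
    using min uvR unfolding minimal_in_class_iff by blast
  ultimately obtain a b N P where rope: "(a, b, N, P) \<in> ropes A" "N \<subseteq> Mho" "P \<subseteq> Omega"
    and "\<not> (I_join A (a, b, N, P) \<subseteq> R \<longleftrightarrow> I_join A (a, b, N, P) \<subseteq> R - {(u, v)})"
    using R unfolding rope_congruence_def acyclic_reorientations_iff by blast
  then have I: "I_join A (a, b, N, P) \<subseteq> R" "(u, v) \<in> I_join A (a, b, N, P)" by blast+
  then have u: "u \<in> P \<union> {a}" and v: "v \<in> N \<union> {b}" by (auto simp: mem_I_join)
  have between: "w \<in> N \<union> P" if "(u, w) \<in> A" "(w, v) \<in> A" for w
    by (rule rope_arc_between[OF rope(1) _ _ that]) (use u v in auto)
  \<comment> \<open>Were \<open>w\<close> in \<open>P\<close>, the arc \<open>(w, v)\<close> would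
    belong to the \<open>I_join\<close>, hence to \<open>R\<close>. The argument for
    \<open>Delta\<close> is symmetric.\<close>
  have "w \<in> N" if "w \<in> nabla A (reorient A R) u v" for w
  proof -
    have w: "(u, w) \<in> R" "(w, v) \<in> A" "(w, v) \<notin> R" using that by (simp_all add: mem_nabla[OF sub])
    have "w \<notin> P"
    proof
      assume "w \<in> P"
      then have "(w, v) \<in> I_join A (a, b, N, P)" using w v by (simp add: mem_I_join)
      then show False using I w by blast
    qed
    then show ?thesis using between[of w] w sub by blast
  qed
  moreover have "w \<in> P" if "w \<in> Delta A (reorient A R) u v" for w
  proof -
    have w: "(u, w) \<in> A" "(u, w) \<notin> R" "(w, v) \<in> R" using that by (simp_all add: mem_Delta[OF sub])
    have "w \<notin> N"
    proof
      assume "w \<in> N"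
      then have "(u, w) \<in> I_join A (a, b, N, P)" using w u by (simp add: mem_I_join)
      then show False using I w by blast
    qed
    then show ?thesis using between[of w] w sub by blast
  qed
  ultimately show ?thesis using rope by blast
qed

text \<open>Arcs outside the transitive reduction are split by \<open>nabla_Delta_split\<close>. The
  induction measures length in the reorientation, since the parts can be longer in
  \<open>A\<close>.\<close>

lemma reduced_arcs_imp_reversed_arcs:
  assumes R: "biclosed A R"
    and red: "\<And>u v. (u, v) \<in> A \<Longrightarrow> (v, u) \<in> transitive_reduction (reorient A R) \<Longrightarrow>
      nabla A (reorient A R) u v \<subseteq> Mho \<and> Delta A (reorient A R) u v \<subseteq> Omega"
    and "(u, v) \<in> R"
  shows "nabla A (reorient A R) u v \<subseteq> Mho \<and> Delta A (reorient A R) u v \<subseteq> Omega"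
proof -
  let ?E = "reorient A R"
  have sub: "R \<subseteq> A" using R by (rule biclosed_subset)
  have ac: "acyclic ?E" using R by (rule biclosed_imp_acyclic)
  obtain f :: "'a \<Rightarrow> nat" where f: "\<And>a b. (a, b) \<in> ?E \<Longrightarrow> f a < f b"
    using finite_acyclic_rank[OF finite_reorient[OF sub] ac] by blast
  show ?thesis using assms(3)
  proof (induction "f u - f v" arbitrary: u v rule: less_induct)
    case less
    have vu: "(v, u) \<in> ?E" and uv: "(u, v) \<in> A" using less.prems by (auto simp: reorient_def sub[THEN subsetD])
    show ?case
    proof (cases "\<exists>c. (v, c) \<in> ?E \<and> (c, u) \<in> ?E")
      case True
      then obtain c where c: "(v, c) \<in> ?E" "(c, u) \<in> ?E" by blast
      have lt: "f u - f c < f u - f v" "f c - f v < f u - f v"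
        using f[OF c(1)] f[OF c(2)] by simp_all
      note IH = less.hyps[OF lt(1)] less.hyps[OF lt(2)]
      show ?thesis
        using nabla_Delta_split[OF R less.prems c] IH by blast
    next
      case False
      then have "(v, u) \<in> transitive_reduction ?E"
        using vu transitive_reduction_reorient[OF sub ac] by blast
      then show ?thesis using red uv by blast
    qed
  qed
qed

text \<open>A congruent \<open>S\<close> contained in \<open>R\<close> contains every arc of
  \<open>R\<close>, by induction on length in \<open>A\<close>: composite arcs by closedness, the
  others through the rope of \<open>nabla_Delta_rope\<close>, which \<open>rev\<close> makes
  admissible.\<close>

lemma reversed_arcs_imp_minimal:
  assumes R: "biclosed A R"
    and rev: "\<And>u v. (u, v) \<in> R \<Longrightarrow>
      nabla A (reorient A R) u v \<subseteq> Mho \<and> Delta A (reorient A R) u v \<subseteq> Omega"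
  shows "minimal_in_class (AR A) (rope_congruence A Mho Omega) R"
proof -
  obtain f :: "'a \<Rightarrow> nat" where f: "\<And>a b. (a, b) \<in> A \<Longrightarrow> f a < f b"
    using finite_acyclic_rank[OF finite_A acyclic_A] by blast
  have sub: "R \<subseteq> A" using R by (rule biclosed_subset)
  have False if RS: "(R, S) \<in> rope_congruence A Mho Omega" and lt: "S \<subset> R" for S
  proof -
    have S: "biclosed A S" using RS by (auto simp: rope_congruence_def acyclic_reorientations_iff)
    have "(a, b) \<in> S" if "(a, b) \<in> R" for a b
      using that
    proof (induction "f b - f a" arbitrary: a b rule: less_induct)
      case less
      have ab: "(a, b) \<in> A" using less.prems sub by blast
      show ?case
      proof (cases "\<exists>c. (a, c) \<in> R \<and> (c, b) \<in> R")
        case True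
        then obtain c where c: "(a, c) \<in> R" "(c, b) \<in> R" by blast
        then have "f a < f c" "f c < f b" using f sub by auto
        then have "(a, c) \<in> S" "(c, b) \<in> S" using less.hyps c by simp_all
        then show ?thesis using biclosed_closed[OF S] ab by blast
      next
        case False
        let ?N = "nabla A (reorient A R) a b" and ?P = "Delta A (reorient A R) a b"
        have "(a, b, ?N, ?P) \<in> ropes A" "I_join A (a, b, ?N, ?P) \<subseteq> R"
          using nabla_Delta_rope[OF R less.prems] False by blast+
        then have "I_join A (a, b, ?N, ?P) \<subseteq> S"
          using RS rev[OF less.prems] unfolding rope_congruence_def by blast
        moreover have "(a, b) \<in> I_join A (a, b, ?N, ?P)" using ab by (simp add: mem_I_join)
        ultimately show ?thesis by blast
      qed
    qed
    then show False using lt by auto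
  qed
  then show ?thesis using R minimal_in_class_iff by blast
qed

lemma minimal_characterization:
  assumes R: "biclosed A R" and E: "E = reorient A R"
  shows "(minimal_in_class (AR A) (rope_congruence A Mho Omega) R \<longleftrightarrow>
        (\<forall>(u, v) \<in> A. (v, u) \<in> transitive_reduction E \<longrightarrow>
           nabla A E u v \<subseteq> Mho \<and> Delta A E u v \<subseteq> Omega)) \<and>
      ((\<forall>(u, v) \<in> A. (v, u) \<in> transitive_reduction E \<longrightarrow>
           nabla A E u v \<subseteq> Mho \<and> Delta A E u v \<subseteq> Omega) \<longleftrightarrow>
        (\<forall>(u, v) \<in> A. (v, u) \<in> E \<longrightarrow>
           nabla A E u v \<subseteq> Mho \<and> Delta A E u v \<subseteq> Omega))"
    (is "(?min \<longleftrightarrow> ?red) \<and> (?red \<longleftrightarrow> ?rev)")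
proof -
  have sub: "R \<subseteq> A" using R by (rule biclosed_subset)
  have "?min \<Longrightarrow> ?red" unfolding E using minimal_imp_reduced_arcs by blast
  moreover have "?red \<Longrightarrow> ?rev"
  proof -
    assume ?red
    then have "nabla A E u v \<subseteq> Mho \<and> Delta A E u v \<subseteq> Omega" if "(u, v) \<in> R" for u v
      unfolding E using reduced_arcs_imp_reversed_arcs[OF R _ that, of Mho Omega] by blast
    then show ?rev using reorient_arc(2)[OF sub] unfolding E by blast
  qed
  moreover have "?rev \<Longrightarrow> ?min"
  proof -
    assume ?rev
    then have "nabla A (reorient A R) u v \<subseteq> Mho \<and> Delta A (reorient A R) u v \<subseteq> Omega"
      if "(u, v) \<in> R" for u v
      using that sub reorient_arc(2)[OF sub] unfolding E by blast
    then show ?min by (rule reversed_arcs_imp_minimal[OF R])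
  qed
  ultimately show ?thesis by blast
qed

section \<open>Maximal elements by complementation\<close>

lemma maximal_in_class_Diff:
  assumes R: "biclosed A R"
  shows "maximal_in_class (AR A) (rope_congruence A Mho Omega) R \<longleftrightarrow>
    minimal_in_class (AR A) (rope_congruence A Omega Mho) (A - R)"
proof -
  have sub: "R \<subseteq> A" using R by (rule biclosed_subset)
  have subS: "S \<subseteq> A" if "(T, S) \<in> rope_congruence A M Om" for S T M Om
    using that by (auto simp: rope_congruence_def acyclic_reorientations_def)
  have "(\<exists>S. (R, S) \<in> rope_congruence A Mho Omega \<and> R \<subset> S) \<longleftrightarrow>
    (\<exists>S. (A - R, S) \<in> rope_congruence A Omega Mho \<and> S \<subset> A - R)" (is "?l \<longleftrightarrow> ?r")
  proof
    assume ?l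
    then obtain S where S: "(R, S) \<in> rope_congruence A Mho Omega" "R \<subset> S" by blast
    then show ?r using rope_congruence_Diff[OF S(1)] subS[OF S(1)] by blast
  next
    assume ?r
    then obtain S where S: "(A - R, S) \<in> rope_congruence A Omega Mho" "S \<subset> A - R" by blast
    have "(R, A - S) \<in> rope_congruence A Mho Omega"
      using rope_congruence_Diff[OF S(1)] double_diff[OF sub subset_refl] by simp
    then show ?l using S(2) sub by blast
  qed
  then show ?thesis
    using R biclosed_Diff[OF R] unfolding minimal_in_class_iff maximal_in_class_iff by blast
qed

lemma reorient_Diff: "R \<subseteq> A \<Longrightarrow> reorient A (A - R) = (reorient A R)\<inverse>"
  by (auto simp: reorient_def)

text \<open>Minimality is applied to \<open>A - R\<close>. Passing to the converse exchanges
  \<open>nabla\<close> and \<open>Delta\<close>, which compensates the exchange of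
  \<open>Mho\<close> and \<open>Omega\<close>.\<close>

lemma maximal_characterization:
  assumes R: "biclosed A R" and E: "E = reorient A R"
  shows "(maximal_in_class (AR A) (rope_congruence A Mho Omega) R \<longleftrightarrow>
        (\<forall>(u, v) \<in> A. (u, v) \<in> transitive_reduction E \<longrightarrow>
           nabla A E u v \<subseteq> Mho \<and> Delta A E u v \<subseteq> Omega)) \<and>
      ((\<forall>(u, v) \<in> A. (u, v) \<in> transitive_reduction E \<longrightarrow>
           nabla A E u v \<subseteq> Mho \<and> Delta A E u v \<subseteq> Omega) \<longleftrightarrow>
        (\<forall>(u, v) \<in> A. (u, v) \<in> E \<longrightarrow>
           nabla A E u v \<subseteq> Mho \<and> Delta A E u v \<subseteq> Omega))"
proof -
  have sub: "R \<subseteq> A" using R by (rule biclosed_subset)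
  have D: "biclosed A (A - R)" using R by (rule biclosed_Diff)
  have subD: "A - R \<subseteq> A" by blast
  have conv: "E\<inverse> = reorient A (A - R)" using reorient_Diff[OF sub] E by simp
  \<comment> \<open>The description of the transitive reduction by two-step paths is visibly
    symmetric under converse.\<close>
  have red: "(v, u) \<in> transitive_reduction (E\<inverse>) \<longleftrightarrow> (u, v) \<in> transitive_reduction E" for u v
    using transitive_reduction_reorient[OF subD biclosed_imp_acyclic[OF D]]
      transitive_reduction_reorient[OF sub biclosed_imp_acyclic[OF R]]
    unfolding conv[symmetric] E[symmetric] by blast
  have sets: "nabla A (E\<inverse>) u v = Delta A E u v" "Delta A (E\<inverse>) u v = nabla A E u v" for u v
    unfolding conv
    unfolding E set_eq_iff mem_nabla[OF sub] mem_nabla[OF subD] mem_Delta[OF sub] mem_Delta[OF subD]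
    using sub by blast+
  show ?thesis
    using minimal_characterization[OF D conv, of Omega Mho]
    unfolding red sets converse_iff maximal_in_class_Diff[OF R, of Mho Omega]
    by (simp only: conj_commute)
qed

end

theorem proposition48:
  fixes V :: "'a set" and A R E :: "('a \<times> 'a) set" and Mho Omega :: "'a set"
  assumes "dag V A"
    and "skeletal V A"
    and "Mho \<subseteq> V" and "Omega \<subseteq> V"
    and "R \<in> acyclic_reorientations A" and "E = reorient A R"
  shows
    "((minimal_in_class (AR A) (coherent_congruence A Mho Omega) R \<longleftrightarrow>
        (\<forall>(u, v) \<in> A. (v, u) \<in> transitive_reduction E \<longrightarrow>
           nabla A E u v \<subseteq> Mho \<and> Delta A E u v \<subseteq> Omega)) \<and>
      ((\<forall>(u, v) \<in> A. (v, u) \<in> transitive_reduction E \<longrightarrow>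
           nabla A E u v \<subseteq> Mho \<and> Delta A E u v \<subseteq> Omega) \<longleftrightarrow>
        (\<forall>(u, v) \<in> A. (v, u) \<in> E \<longrightarrow>
           nabla A E u v \<subseteq> Mho \<and> Delta A E u v \<subseteq> Omega))) \<and>
     ((maximal_in_class (AR A) (coherent_congruence A Mho Omega) R \<longleftrightarrow>
        (\<forall>(u, v) \<in> A. (u, v) \<in> transitive_reduction E \<longrightarrow>
           nabla A E u v \<subseteq> Mho \<and> Delta A E u v \<subseteq> Omega)) \<and>
      ((\<forall>(u, v) \<in> A. (u, v) \<in> transitive_reduction E \<longrightarrow>
           nabla A E u v \<subseteq> Mho \<and> Delta A E u v \<subseteq> Omega) \<longleftrightarrow>
        (\<forall>(u, v) \<in> A. (u, v) \<in> E \<longrightarrow>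
           nabla A E u v \<subseteq> Mho \<and> Delta A E u v \<subseteq> Omega)))"
proof -
  interpret skeletal_dag V A using assms(1,2) by unfold_locales
  have "biclosed A R" using assms(5) by (simp add: acyclic_reorientations_iff)
  then show ?thesis
    unfolding coherent_congruence_eq
    by (intro conjI[OF minimal_characterization maximal_characterization] assms(6))
qed

end
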